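(* Let $\mu=\mu_B$ be the NC Clark measure of $B\in[\mathbb H^\infty_d]_1$ (with $B\not\equiv1$). If $B$ is inner (that is, $B(R)$ is an isometry on $\mathbb H^2_d$), then $\mu$ is singular.
   Context: Fix $d\in\mathbb N$. $\mathbb F^d$ is the free monoid of words in $1,\dots,d$, with unit $\emptyset$; $\alpha^{\mathrm t}$ is the word $\alpha$ reversed. $\mathbb H^2_d=\ell^2(\mathbb F^d)$ has orthonormal basis $\{e_\alpha\}$, and $1:=e_\emptyset$. Inner products and forms are conjugate-linear in the first argument. $L_ke_\alpha=e_{k\alpha}$ and $R_ke_\alpha=e_{\alpha k}$ are the left and right free shifts; for $\alpha=i_1\cdots i_n$, $L^\alpha=L_{i_1}\cdots L_{i_n}$. $\mathcal A_d$ is the norm-closed unital algebra generated by $L_1,\dots,L_d$; $a\in\mathcal A_d$ is identified with $a1\in\mathbb H^2_d$. $\mathscr A_d$ is the norm closure of $\mathcal A_d+\mathcal A_d^*$; it contains $\mathcal A_d^*\mathcal A_d$. A positive NC measure is a positive linear functional on $\mathscr A_d$. Singularity: let $q_\mu(a_1,a_2)=\mu(a_1^*a_2)$, with dense domain $\mathcal A_d\subset\mathbb H^2_d$. A densely-defined positive semi-definite form is closable if it has a closed extension. By a theorem of B. Simon there is a maximal closable positive semi-definite form bounded above by $q_\mu$ (where $q_1\le q_2$ means $\mathrm{Dom}\,q_2\subseteq\mathrm{Dom}\,q_1$ and $q_1(h,h)\le q_2(h,h)$ on $\mathrm{Dom}\,q_2$). $\mu$ is singular if this maximal form is zero. $\mathbb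 B^d_{\mathbb N}=\bigsqcup_n\mathbb B^d_n$, where $\mathbb B^d_n$ is the set of $d$-tuples $Z$ of complex $n\times n$ matrices with $\sum_kZ_kZ_k^*<I_n$. An NC function maps $\mathbb B^d_n$ to $\mathbb C^{n\times n}$ and respects direct sums and joint similarities. $\mathbb H^\infty_d$ is the algebra of bounded NC functions on $\mathbb B^d_{\mathbb N}$ with supremum norm, and $[\mathbb H^\infty_d]_1$ is its closed unit ball. For $B(Z)=\sum_\alpha B_\alpha Z^\alpha\in\mathbb H^\infty_d$, $B(L)$ is left multiplication by $B$ on $\mathbb H^2_d$ (square-summable power series in non-commuting variables, with $e_\alpha\leftrightarrow Z^\alpha$), and $B(R)=U_{\mathrm t}B(L)U_{\mathrm t}$, where $U_{\mathrm t}e_\alpha=e_{\alpha^{\mathrm t}}$. $B$ is inner if $B(L)$, equivalently $B(R)$, is an isometry. $H_B=(I-B)^{-1}(I+B)=\sum_\alpha H_{B;\alpha}Z^\alpha$. The NC Clark measure $\mu_B$ is the positive NC measure determined by $\mu_B(I)=\mathrm{Re}\,H_{B;\emptyset}$ and $\mu_B(L^\alpha)=\frac12\overline{H_{B;\alpha^{\mathrm t}}}$ for $\alpha\ne\emptyset$. *)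

theory Defs
  imports
    "HOL-Analysis.Infinite_Sum"
    "HOL-Analysis.Inner_Product"
    "HOL-Analysis.Bounded_Linear_Function"
    "HOL-Library.Nonpos_Ints"
    "Jordan_Normal_Form.Matrix"
    "Jordan_Normal_Form.Gauss_Jordan_Elimination"
    "Jordan_Normal_Form.Schur_Decomposition"
begin

section \<open>The complex Hilbert space of square-summable functions\<close>

lemma ell2_cross_summable:
  fixes f g :: "'a \<Rightarrow> complex"
  assumes "(\<lambda>x. (cmod (f x))\<^sup>2) summable_on A" "(\<lambda>x. (cmod (g x))\<^sup>2) summable_on A"
  shows "(\<lambda>x. cnj (f x) * g x) abs_summable_on A"
proof (rule summable_on_comparison_test)
  show "(\<lambda>x. (cmod (f x))\<^sup>2 + (cmod (g x))\<^sup>2) summable_on A"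
    using assms by (rule summable_on_add)
  show "norm (cnj (f x) * g x) \<le> (cmod (f x))\<^sup>2 + (cmod (g x))\<^sup>2" for x
  proof -
    have "0 \<le> (cmod (f x) - cmod (g x))\<^sup>2" by simp
    then have "2 * (cmod (f x) * cmod (g x)) \<le> (cmod (f x))\<^sup>2 + (cmod (g x))\<^sup>2"
      by (simp add: power2_diff)
    moreover have "0 \<le> cmod (f x) * cmod (g x)" by simp
    ultimately show ?thesis
      unfolding norm_mult complex_mod_cnj by linarith
  qed
qed auto

lemma ell2_add_summable:
  fixes f g :: "'a \<Rightarrow> complex"
  assumes "(\<lambda>x. (cmod (f x))\<^sup>2) summable_on A" "(\<lambda>x. (cmod (g x))\<^sup>2) summable_on A"
  shows "(\<lambda>x. (cmod (f x + g x))\<^sup>2) summable_on A"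
proof (rule summable_on_comparison_test)
  show "(\<lambda>x. 2 * (cmod (f x))\<^sup>2 + 2 * (cmod (g x))\<^sup>2) summable_on A"
    using assms by (intro summable_on_add summable_on_cmult_right)
  show "(cmod (f x + g x))\<^sup>2 \<le> 2 * (cmod (f x))\<^sup>2 + 2 * (cmod (g x))\<^sup>2" for x
  proof -
    have "(cmod (f x + g x))\<^sup>2 \<le> (cmod (f x) + cmod (g x))\<^sup>2"
      by (intro power_mono norm_triangle_ineq norm_ge_zero)
    moreover have "0 \<le> (cmod (f x) - cmod (g x))\<^sup>2" by simp
    ultimately show ?thesis by (simp add: power2_diff power2_sum)
  qed
qed auto

lemma ell2_cmult_summable:
  fixes f :: "'a \<Rightarrow> complex"
  assumes "(\<lambda>x. (cmod (f x))\<^sup>2) summable_on A"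
  shows "(\<lambda>x. (cmod (c * f x))\<^sup>2) summable_on A"
  using assms by (simp add: norm_mult power_mult_distrib summable_on_cmult_right)

typedef 'a ell2 = "{f :: 'a \<Rightarrow> complex. (\<lambda>x. (cmod (f x))\<^sup>2) summable_on UNIV}"
  morphisms ell2_fun Ell2
  by (rule exI[of _ "\<lambda>_. 0"]) simp

setup_lifting type_definition_ell2

lift_definition cinner :: "'a ell2 \<Rightarrow> 'a ell2 \<Rightarrow> complex"
  is "\<lambda>f g. \<Sum>\<^sub>\<infinity>x. cnj (f x) * g x" .

lift_definition cscale :: "complex \<Rightarrow> 'a ell2 \<Rightarrow> 'a ell2"
  is "\<lambda>c f x. c * f x" by (rule ell2_cmult_summable)

instantiation ell2 :: (type) real_vector
begin

lift_definition zero_ell2 :: "'a ell2" is "\<lambda>_. 0" by simp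

lift_definition plus_ell2 :: "'a ell2 \<Rightarrow> 'a ell2 \<Rightarrow> 'a ell2" is "\<lambda>f g x. f x + g x"
  by (rule ell2_add_summable)

lift_definition uminus_ell2 :: "'a ell2 \<Rightarrow> 'a ell2" is "\<lambda>f x. - f x" by simp

lift_definition minus_ell2 :: "'a ell2 \<Rightarrow> 'a ell2 \<Rightarrow> 'a ell2" is "\<lambda>f g x. f x - g x"
proof -
  fix f g :: "'a \<Rightarrow> complex"
  assume "(\<lambda>x. (cmod (f x))\<^sup>2) summable_on UNIV" "(\<lambda>x. (cmod (g x))\<^sup>2) summable_on UNIV"
  then show "(\<lambda>x. (cmod (f x - g x))\<^sup>2) summable_on UNIV"
    using ell2_add_summable[of f UNIV "\<lambda>x. - g x"] by simp
qed

lift_definition scaleR_ell2 :: "real \<Rightarrow> 'a ell2 \<Rightarrow> 'a ell2" is "\<lambda>r f x. of_real r * f x"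
  by (rule ell2_cmult_summable)

instance
  by standard (transfer, simp add: algebra_simps)+

end

lemma cinner_add_left: "cinner (f + g) h = cinner f h + cinner g h"
  by transfer (auto simp: distrib_right intro!: infsum_add ell2_cross_summable[THEN abs_summable_summable])

lemma cinner_add_right: "cinner h (f + g) = cinner h f + cinner h g"
  by transfer (auto simp: distrib_left intro!: infsum_add ell2_cross_summable[THEN abs_summable_summable])

lemma cinner_cscale_left: "cinner (cscale c f) g = cnj c * cinner f g"
  by transfer (simp add: mult.assoc infsum_cmult_right')

lemma cinner_cscale_right: "cinner f (cscale c g) = c * cinner f g"
  by transfer (simp add: mult.left_commute infsum_cmult_right')

lemma cinner_commute: "cinner f g = cnj (cinner g f)"
  by transfer (simp add: mult.commute flip: infsum_cnj)

lemma cinner_self: "cinner f f = of_real (\<Sum>\<^sub>\<infinity>x. (cmod (ell2_fun f x))\<^sup>2)"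
proof -
  have "cnj z * z = of_real ((cmod z)\<^sup>2)" for z
    by (metis complex_norm_square mult.commute)
  then show ?thesis
    unfolding cinner.rep_eq
    using infsumI[OF has_sum_of_real[OF has_sum_infsum]] ell2_fun[of f]
    by (simp del: of_real_power)
qed

lemma scaleR_cscale: "r *\<^sub>R f = cscale (of_real r) f"
  by transfer simp

instantiation ell2 :: (type) real_inner
begin

definition inner_ell2 :: "'a ell2 \<Rightarrow> 'a ell2 \<Rightarrow> real"
  where "inner_ell2 f g = Re (cinner f g)"

definition norm_ell2 :: "'a ell2 \<Rightarrow> real"
  where "norm_ell2 f = sqrt (inner f f)"

definition dist_ell2 :: "'a ell2 \<Rightarrow> 'a ell2 \<Rightarrow> real"
  where "dist_ell2 f g = norm (f - g)"

definition sgn_ell2 :: "'a ell2 \<Rightarrow> 'a ell2"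
  where "sgn_ell2 f = f /\<^sub>R norm f"

definition uniformity_ell2 :: "('a ell2 \<times> 'a ell2) filter"
  where "uniformity_ell2 = (INF e\<in>{0<..}. principal {(x, y). dist x y < e})"

definition open_ell2 :: "'a ell2 set \<Rightarrow> bool"
  where "open_ell2 S = (\<forall>x\<in>S. \<forall>\<^sub>F (x', y) in uniformity. x' = x \<longrightarrow> y \<in> S)"

instance
proof
  fix f g h :: "'a ell2" and r :: real
  show "inner f g = inner g f"
    unfolding inner_ell2_def by (subst cinner_commute) simp
  show "inner (f + g) h = inner f h + inner g h"
    by (simp add: inner_ell2_def cinner_add_left)
  show "inner (r *\<^sub>R f) g = r * inner f g"
    by (simp add: inner_ell2_def scaleR_cscale cinner_cscale_left)
  show "0 \<le> inner f f"
    by (simp add: inner_ell2_def cinner_self infsum_nonneg)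
  show "inner f f = 0 \<longleftrightarrow> f = 0"
  proof
    assume "inner f f = 0"
    then have *: "(\<Sum>\<^sub>\<infinity>x. (cmod (ell2_fun f x))\<^sup>2) = 0"
      by (simp add: inner_ell2_def cinner_self)
    have "(cmod (ell2_fun f x))\<^sup>2 = 0" for x
      by (rule nonneg_infsum_le_0D[where A = UNIV]) (use * ell2_fun[of f] in auto)
    then show "f = 0" by transfer auto
  next
    assume "f = 0"
    then show "inner f f = 0" unfolding inner_ell2_def by (simp add: cinner_self zero_ell2.rep_eq)
  qed
qed (auto simp: norm_ell2_def dist_ell2_def sgn_ell2_def uniformity_ell2_def open_ell2_def)

end

lemma norm_ell2_square: "(norm f)\<^sup>2 = (\<Sum>\<^sub>\<infinity>x. (cmod (ell2_fun f x))\<^sup>2)"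
  by (simp add: norm_ell2_def inner_ell2_def cinner_self infsum_nonneg)

lemma norm_cscale: "norm (cscale c f) = cmod c * norm f"
proof -
  have "(norm (cscale c f))\<^sup>2 = (cmod c * norm f)\<^sup>2"
    by (simp add: norm_ell2_square cscale.rep_eq norm_mult power_mult_distrib infsum_cmult_right')
  then show ?thesis by simp
qed

lift_definition ket :: "'a \<Rightarrow> 'a ell2" is "\<lambda>a x. if x = a then 1 else 0"
proof -
  fix a :: 'a
  have "(\<lambda>x. (cmod (if x = a then 1 else 0))\<^sup>2) summable_on {a}" by simp
  then show "(\<lambda>x. (cmod (if x = a then 1 else 0))\<^sup>2) summable_on UNIV"
    by (rule summable_on_cong_neutral[THEN iffD1, rotated -1]) auto
qed

section \<open>Operators\<close>

text \<open>
  Library operators \<open>\<Rightarrow>\<^sub>L\<close> are only real-linear; all operators singled out below are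
  complex-linear.
\<close>

type_synonym 'a operator = "'a ell2 \<Rightarrow>\<^sub>L 'a ell2"

lift_definition scale_op :: "complex \<Rightarrow> 'a operator" is cscale
proof -
  fix c :: complex
  show "bounded_linear (cscale c :: 'a ell2 \<Rightarrow> 'a ell2)"
  proof (rule bounded_linear_intro)
    show "cscale c (f + g) = cscale c f + cscale c g" for f g :: "'a ell2"
      by transfer (simp add: distrib_left)
    show "cscale c (r *\<^sub>R f) = r *\<^sub>R cscale c f" for r and f :: "'a ell2"
      by transfer (simp add: mult.left_commute)
    show "norm (cscale c f) \<le> norm f * cmod c" for f :: "'a ell2"
      by (simp add: norm_cscale)
  qed
qed

definition adj :: "'a operator \<Rightarrow> 'a operator"
  where "adj T = (THE S :: 'a operator. \<forall>f g. cinner (T f) g = cinner f (S g))"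

definition positive_op :: "'a operator \<Rightarrow> bool"
  where "positive_op T \<longleftrightarrow> (\<forall>f. cinner f (T f) \<in> \<real>\<^sub>\<ge>\<^sub>0)"

section \<open>The free shift and the free disk system\<close>

text \<open>
  The alphabet is a finite type \<open>'d\<close> with \<open>d\<close> elements; words are lists, and
  \<open>'d list ell2\<close> is the full Fock space.
\<close>

fun prepend_coeff :: "'d \<Rightarrow> ('d list \<Rightarrow> complex) \<Rightarrow> 'd list \<Rightarrow> complex" where
  "prepend_coeff k f [] = 0"
| "prepend_coeff k f (j # \<gamma>) = (if j = k then f \<gamma> else 0)"

lemma prepend_coeff_has_sum:
  assumes "((\<lambda>\<gamma>. (cmod (f \<gamma>))\<^sup>2) has_sum s) UNIV"
  shows "((\<lambda>\<beta>. (cmod (prepend_coeff k f \<beta>))\<^sup>2) has_sum s) UNIV"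
proof -
  have "((\<lambda>\<beta>. (cmod (prepend_coeff k f \<beta>))\<^sup>2) has_sum s) (range ((#) k))"
    by (subst has_sum_reindex) (use assms in \<open>auto simp: inj_on_def o_def\<close>)
  moreover have "(cmod (prepend_coeff k f \<beta>))\<^sup>2 = 0" if "\<beta> \<notin> range ((#) k)" for \<beta>
    using that by (cases \<beta>) auto
  ultimately show ?thesis
    by (subst has_sum_cong_neutral[where T = "range ((#) k)"]) auto
qed

lift_definition lshift_fun :: "'d \<Rightarrow> 'd list ell2 \<Rightarrow> 'd list ell2" is prepend_coeff
  unfolding summable_on_def by (elim exE, rule exI) (rule prepend_coeff_has_sum)

lemma norm_lshift_fun: "norm (lshift_fun k f) = norm f"
proof -
  have "((\<lambda>\<gamma>. (cmod (ell2_fun f \<gamma>))\<^sup>2) has_sum (norm f)\<^sup>2) UNIV"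
    using ell2_fun[of f] by (simp add: norm_ell2_square)
  then have "((\<lambda>\<beta>. (cmod (ell2_fun (lshift_fun k f) \<beta>))\<^sup>2) has_sum (norm f)\<^sup>2) UNIV"
    unfolding lshift_fun.rep_eq by (rule prepend_coeff_has_sum)
  then have "(norm (lshift_fun k f))\<^sup>2 = (norm f)\<^sup>2"
    unfolding norm_ell2_square[of "lshift_fun k f"] by (rule infsumI)
  then show ?thesis by simp
qed

lift_definition lshift :: "'d \<Rightarrow> 'd list operator" is lshift_fun
proof -
  fix k :: 'd
  show "bounded_linear (lshift_fun k)"
  proof (rule bounded_linear_intro)
    show "lshift_fun k (f + g) = lshift_fun k f + lshift_fun k g" for f g
    proof (transfer, rule ext)
      fix k :: 'd and f g \<beta>
      show "prepend_coeff k (\<lambda>x. f x + g x) \<beta> = prepend_coeff k f \<beta> + prepend_coeff k g \<beta>"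
        by (cases \<beta>) auto
    qed
    show "lshift_fun k (r *\<^sub>R f) = r *\<^sub>R lshift_fun k f" for r f
    proof (transfer, rule ext)
      fix k :: 'd and r f \<beta>
      show "prepend_coeff k (\<lambda>x. of_real r * f x) \<beta> = of_real r * prepend_coeff k f \<beta>"
        by (cases \<beta>) auto
    qed
    show "norm (lshift_fun k f) \<le> norm f * 1" for f
      by (simp add: norm_lshift_fun)
  qed
qed

lemma lshift_ket: "lshift k (ket \<alpha>) = ket (k # \<alpha>)"
proof -
  have "prepend_coeff k (ell2_fun (ket \<alpha>)) \<beta> = ell2_fun (ket (k # \<alpha>)) \<beta>" for \<beta>
    by (cases \<beta>) (auto simp: ket.rep_eq)
  then show ?thesis
    by (auto simp: lshift.rep_eq lshift_fun.rep_eq simp flip: ell2_fun_inject)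
qed

definition lshift_word :: "'d list \<Rightarrow> 'd list operator"
  where "lshift_word \<alpha> = foldr (\<lambda>k T. lshift k o\<^sub>L T) \<alpha> id_blinfun"

inductive_set free_polys :: "'d list operator set" where
  scalar: "scale_op c \<in> free_polys"
| shift: "lshift k \<in> free_polys"
| add: "S \<in> free_polys \<Longrightarrow> T \<in> free_polys \<Longrightarrow> S + T \<in> free_polys"
| mult: "S \<in> free_polys \<Longrightarrow> T \<in> free_polys \<Longrightarrow> S o\<^sub>L T \<in> free_polys"

definition disk_algebra :: "'d list operator set"
  where "disk_algebra = closure free_polys"

definition disk_system :: "'d list operator set"
  where "disk_system = closure {S + adj T | S T. S \<in> disk_algebra \<and> T \<in> disk_algebra}"

text \<open>Only the values on \<open>disk_system\<close> matter for an NC measure.\<close>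

definition positive_nc_measure :: "('d list operator \<Rightarrow> complex) \<Rightarrow> bool"
  where "positive_nc_measure \<mu> \<longleftrightarrow>
    (\<forall>S\<in>disk_system. \<forall>T\<in>disk_system. \<mu> (S + T) = \<mu> S + \<mu> T) \<and>
    (\<forall>c. \<forall>T\<in>disk_system. \<mu> (scale_op c o\<^sub>L T) = c * \<mu> T) \<and>
    (\<forall>T\<in>disk_system. positive_op T \<longrightarrow> \<mu> T \<in> \<real>\<^sub>\<ge>\<^sub>0)"

section \<open>Quadratic forms and singularity\<close>

text \<open>A form is a domain together with a function of two arguments, of which only the values
  on the domain matter.\<close>

type_synonym 'a form = "'a ell2 set \<times> ('a ell2 \<Rightarrow> 'a ell2 \<Rightarrow> complex)"

definition psd_form :: "'a form \<Rightarrow> bool"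
  where "psd_form Q \<longleftrightarrow> (case Q of (D, q) \<Rightarrow>
    0 \<in> D \<and> (\<forall>f\<in>D. \<forall>g\<in>D. f + g \<in> D) \<and> (\<forall>c. \<forall>f\<in>D. cscale c f \<in> D) \<and>
    closure D = UNIV \<and>
    (\<forall>f\<in>D. \<forall>g\<in>D. \<forall>h\<in>D. q f (g + h) = q f g + q f h \<and> q (g + h) f = q g f + q h f) \<and>
    (\<forall>c. \<forall>f\<in>D. \<forall>g\<in>D. q f (cscale c g) = c * q f g \<and> q (cscale c f) g = cnj c * q f g) \<and>
    (\<forall>f\<in>D. q f f \<in> \<real>\<^sub>\<ge>\<^sub>0))"

text \<open>Closedness is completeness of the domain for the norm
  \<open>sqrt (q h h + (norm h)\<^sup>2)\<close>.\<close>

definition closed_form :: "'a form \<Rightarrow> bool"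
  where "closed_form Q \<longleftrightarrow> psd_form Q \<and> (case Q of (D, q) \<Rightarrow>
    \<forall>X h. (\<forall>n::nat. X n \<in> D) \<and> X \<longlonglongrightarrow> h \<and>
      (\<forall>e>0. \<exists>N. \<forall>m\<ge>N. \<forall>n\<ge>N. cmod (q (X m - X n) (X m - X n)) < e) \<longrightarrow>
      h \<in> D \<and> (\<lambda>n. q (X n - h) (X n - h)) \<longlonglongrightarrow> 0)"

definition form_extends :: "'a form \<Rightarrow> 'a form \<Rightarrow> bool"
  where "form_extends Q' Q \<longleftrightarrow>
    fst Q \<subseteq> fst Q' \<and> (\<forall>f\<in>fst Q. \<forall>g\<in>fst Q. snd Q' f g = snd Q f g)"

definition closable_form :: "'a form \<Rightarrow> bool"
  where "closable_form Q \<longleftrightarrow> psd_form Q \<and> (\<exists>Q'. closed_form Q' \<and> form_extends Q' Q)"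

definition form_le :: "'a form \<Rightarrow> 'a form \<Rightarrow> bool"
  where "form_le Q1 Q2 \<longleftrightarrow>
    fst Q2 \<subseteq> fst Q1 \<and> (\<forall>h\<in>fst Q2. Re (snd Q1 h h) \<le> Re (snd Q2 h h))"

definition is_max_closable :: "'a form \<Rightarrow> 'a form \<Rightarrow> bool"
  where "is_max_closable Q Q0 \<longleftrightarrow> closable_form Q0 \<and> form_le Q0 Q \<and>
    (\<forall>Q'. closable_form Q' \<and> form_le Q' Q \<longrightarrow> form_le Q' Q0)"

text \<open>\<open>disk_symbol f\<close> is the element \<open>a\<close> of the disk algebra that is identified with
  the vector \<open>f = a 1\<close>; it is unique because every such \<open>a\<close> commutes with the right shifts.\<close>

definition disk_symbol :: "'d list ell2 \<Rightarrow> 'd list operator"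
  where "disk_symbol f = (THE a. a \<in> disk_algebra \<and> a (ket []) = f)"

definition nc_form :: "('d list operator \<Rightarrow> complex) \<Rightarrow> 'd list form"
  where "nc_form \<mu> = ((\<lambda>a. blinfun_apply a (ket [])) ` disk_algebra,
    \<lambda>f g. \<mu> (adj (disk_symbol f) o\<^sub>L disk_symbol g))"

text \<open>The maximal closable form is unique: its domain is that of \<open>nc_form \<mu>\<close> and it is
  determined by its diagonal.\<close>

definition singular_nc_measure :: "('d list operator \<Rightarrow> complex) \<Rightarrow> bool"
  where "singular_nc_measure \<mu> \<longleftrightarrow>
    (\<exists>Q0. is_max_closable (nc_form \<mu>) Q0 \<and> (\<forall>f\<in>fst Q0. \<forall>g\<in>fst Q0. snd Q0 f g = 0))"

section \<open>NC functions on the row ball\<close>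

definition vec_nrm :: "complex vec \<Rightarrow> real"
  where "vec_nrm v = sqrt (Re (v \<bullet>c v))"

definition mat_nrm :: "complex mat \<Rightarrow> real"
  where "mat_nrm A = (SUP v\<in>{v \<in> carrier_vec (dim_col A). vec_nrm v \<le> 1}. vec_nrm (A *\<^sub>v v))"

definition row_gram :: "nat \<Rightarrow> ('d::finite \<Rightarrow> complex mat) \<Rightarrow> complex mat"
  where "row_gram n Z = mat n n (\<lambda>(i, j). \<Sum>k\<in>UNIV. (Z k * mat_adjoint (Z k)) $$ (i, j))"

definition row_ball :: "nat \<Rightarrow> ('d::finite \<Rightarrow> complex mat) set"
  where "row_ball n = {Z. (\<forall>k. Z k \<in> carrier_mat n n) \<and>
    (\<forall>v\<in>carrier_vec n. v \<noteq> 0\<^sub>v n \<longrightarrow> 0 < Re (((1\<^sub>m n - row_gram n Z) *\<^sub>v v) \<bullet>c v))}"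

definition nc_ball :: "('d::finite \<Rightarrow> complex mat) set"
  where "nc_ball = (\<Union>n\<in>{1..}. row_ball n)"

definition dsum :: "complex mat \<Rightarrow> complex mat \<Rightarrow> complex mat"
  where "dsum A C = four_block_mat A (0\<^sub>m (dim_row A) (dim_col C)) (0\<^sub>m (dim_row C) (dim_col A)) C"

definition nc_function :: "(('d::finite \<Rightarrow> complex mat) \<Rightarrow> complex mat) \<Rightarrow> bool"
  where "nc_function B \<longleftrightarrow>
    (\<forall>n\<ge>1. \<forall>Z\<in>row_ball n. B Z \<in> carrier_mat n n) \<and>
    (\<forall>Z\<in>nc_ball. \<forall>W\<in>nc_ball. B (\<lambda>k. dsum (Z k) (W k)) = dsum (B Z) (B W)) \<and>
    (\<forall>Z\<in>nc_ball. \<forall>W\<in>nc_ball. \<forall>P S.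
      (\<forall>k. similar_mat_wit (W k) (Z k) P S) \<longrightarrow> similar_mat_wit (B W) (B Z) P S)"

definition nc_Hinfty :: "(('d::finite \<Rightarrow> complex mat) \<Rightarrow> complex mat) set"
  where "nc_Hinfty = {B. nc_function B \<and> bdd_above ((\<lambda>Z. mat_nrm (B Z)) ` nc_ball)}"

definition nc_sup_norm :: "(('d::finite \<Rightarrow> complex mat) \<Rightarrow> complex mat) \<Rightarrow> real"
  where "nc_sup_norm B = (SUP Z\<in>nc_ball. mat_nrm (B Z))"

definition nc_Hinfty_unit_ball :: "(('d::finite \<Rightarrow> complex mat) \<Rightarrow> complex mat) set"
  where "nc_Hinfty_unit_ball = {B \<in> nc_Hinfty. nc_sup_norm B \<le> 1}"

definition mat_word :: "nat \<Rightarrow> ('d \<Rightarrow> complex mat) \<Rightarrow> 'd list \<Rightarrow> complex mat"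
  where "mat_word n Z \<alpha> = foldr (\<lambda>k M. Z k * M) \<alpha> (1\<^sub>m n)"

text \<open>\<open>nc_expansion F c\<close> states that \<open>F(Z) = (\<Sum>\<alpha>. c \<alpha> Z^\<alpha>)\<close> on the NC ball. The
  coefficients \<open>c\<close> are determined by \<open>F\<close> (evaluate at jointly nilpotent tuples), and for
  bounded \<open>F\<close>, as well as for the function \<open>nc_herglotz B\<close> of a contractive \<open>B \<noteq> I\<close> below, they exist,
  the series being unconditionally convergent at every point.\<close>

definition nc_expansion ::
  "(('d::finite \<Rightarrow> complex mat) \<Rightarrow> complex mat) \<Rightarrow> ('d list \<Rightarrow> complex) \<Rightarrow> bool"
  where "nc_expansion F c \<longleftrightarrow> (\<forall>n\<ge>1. \<forall>Z\<in>row_ball n. F Z \<in> carrier_mat n n \<and>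
    (\<forall>i<n. \<forall>j<n. ((\<lambda>\<alpha>. c \<alpha> * mat_word n Z \<alpha> $$ (i, j)) has_sum F Z $$ (i, j)) UNIV))"

section \<open>Inner functions and NC Clark measures\<close>

text \<open>Multiplication of power series: the coefficient at \<open>\<gamma>\<close> runs over all factorizations
  \<open>\<gamma> = \<alpha> @ \<beta>\<close>.\<close>

definition is_left_mult :: "('d list \<Rightarrow> complex) \<Rightarrow> 'd list operator \<Rightarrow> bool"
  where "is_left_mult b M \<longleftrightarrow> (\<forall>f \<gamma>.
    ell2_fun (M f) \<gamma> = (\<Sum>i\<le>length \<gamma>. b (take i \<gamma>) * ell2_fun f (drop i \<gamma>)))"

lift_definition flip_word :: "'d list ell2 \<Rightarrow> 'd list ell2" is "\<lambda>f \<alpha>. f (rev \<alpha>)"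
proof -
  fix f :: "'d list \<Rightarrow> complex"
  assume "(\<lambda>\<alpha>. (cmod (f \<alpha>))\<^sup>2) summable_on UNIV"
  moreover have "bij (rev :: 'd list \<Rightarrow> 'd list)"
    by (rule involuntory_imp_bij) simp
  ultimately show "(\<lambda>\<alpha>. (cmod (f (rev \<alpha>)))\<^sup>2) summable_on UNIV"
    using summable_on_reindex_bij_betw[of rev UNIV UNIV "\<lambda>\<alpha>. (cmod (f \<alpha>))\<^sup>2"] by simp
qed

text \<open>\<open>M\<close> is \<open>B(L)\<close>, and \<open>flip_word \<circ> M \<circ> flip_word\<close> is \<open>B(R)\<close>.\<close>

definition nc_inner :: "(('d::finite \<Rightarrow> complex mat) \<Rightarrow> complex mat) \<Rightarrow> bool"
  where "nc_inner B \<longleftrightarrow> (\<exists>b M. nc_expansion B b \<and> is_left_mult b M \<and>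
    (\<forall>f. norm (flip_word (M (flip_word f))) = norm f))"

text \<open>Meaningful for \<open>B\<close> in the unit ball that is not identically the identity: then
  \<open>I - B(Z)\<close> is invertible at every point of the NC ball.\<close>

definition nc_herglotz ::
  "(('d::finite \<Rightarrow> complex mat) \<Rightarrow> complex mat) \<Rightarrow> ('d \<Rightarrow> complex mat) \<Rightarrow> complex mat"
  where "nc_herglotz B Z = (let n = dim_row (B Z) in
    the (mat_inverse (1\<^sub>m n - B Z)) * (1\<^sub>m n + B Z))"

definition is_nc_clark_measure ::
  "(('d::finite \<Rightarrow> complex mat) \<Rightarrow> complex mat) \<Rightarrow> ('d list operator \<Rightarrow> complex) \<Rightarrow> bool"
  where "is_nc_clark_measure B \<mu> \<longleftrightarrow> positive_nc_measure \<mu> \<and>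
    (\<exists>h. nc_expansion (nc_herglotz B) h \<and>
      \<mu> id_blinfun = of_real (Re (h [])) \<and>
      (\<forall>\<alpha>. \<alpha> \<noteq> [] \<longrightarrow> \<mu> (lshift_word \<alpha>) = cnj (h (rev \<alpha>)) / 2))"

end

theory Submission
  imports Defs
begin

text \<open>
  Let \<open>N = B(R)\<close>, let \<open>\<beta>\<close> be the coefficient family of \<open>B(R) 1\<close>, that is \<open>\<beta> \<gamma> = b (rev \<gamma>)\<close>
  for the coefficients \<open>b\<close> of \<open>B\<close>, and let \<open>q\<close> be the form of the Clark measure \<open>\<mu>\<close>. The zero form is closable and lies below \<open>q\<close>,
  so the claim is that every closable form \<open>q'\<close> below \<open>q\<close> vanishes on the domain of \<open>q\<close>. As \<open>q\<close> is
  bounded by the operator norm, polynomials suffice, and for them it is enough to find,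
  for each polynomial \<open>p\<close>, polynomials \<open>p\<^sub>n\<close> that tend to \<open>0\<close> in the Fock space and to \<open>p\<close> for \<open>q\<close>:
  the sequence is then Cauchy for \<open>q'\<close>, closability gives \<open>q'(p\<^sub>n, p\<^sub>n) \<rightarrow> 0\<close>, and
  \<open>q'(p - p\<^sub>n, p - p\<^sub>n) \<rightarrow> 0\<close> because \<open>q' \<le> q\<close>; hence \<open>q'(p, p) = 0\<close>
  (\<open>closable_form_vanishes\<close>). In one variable this says that the same polynomials can
  approximate \<open>0\<close> in \<open>L\<^sup>2\<close> of the circle and any given polynomial in \<open>L\<^sup>2(\<mu>)\<close>.

  The sequence comes from a model of \<open>q\<close> inside the Fock space. The weighted Cauchy transform
  \<open>V p = (I - N) C p\<close>, where \<open>C p\<close> has the coefficients \<open>\<mu>((L\<^sup>\<alpha>)\<^sup>* p)\<close>, satisfies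
  \<open>q(p, p) = \<parallel>V p\<parallel>\<^sup>2\<close> and has its range in the orthogonal complement of the range of \<open>N\<close>. Both facts
  need \<open>N\<close> to be isometric. The vectors \<open>v \<alpha> = V L\<^sup>\<alpha>\<close> are given by an explicit
  recursion on \<open>\<alpha>\<close>, from which orthogonality (\<open>range_N_orthogonal_v\<close>), the inner products
  (\<open>gram_Cons_Cons\<close> and its companions) and the formula \<open>V = (I - N) C\<close> (\<open>v_model_space\<close>) are read off.

  It remains to see that \<open>(0, V p)\<close> is in the closure of the graph of \<open>V\<close> (\<open>vertical_closure\<close>). Project
  \<open>(0, V p)\<close> orthogonally to that closure and write the residual as \<open>(-f, g)\<close>. Orthogonality to
  \<open>(e\<^sub>\<alpha>, v \<alpha>)\<close> says that \<open>f\<close> has the coefficients \<open>\<langle>v \<alpha>, g\<rangle>\<close>, so \<open>f\<close> is the Cauchy transform of \<open>g\<close>,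
  which is now square-summable; therefore \<open>g = f - N f\<close>. Since \<open>g\<close> is orthogonal to \<open>N f\<close>, also
  \<open>\<langle>N f, f\<rangle> = \<parallel>N f\<parallel>\<^sup>2 = \<parallel>f\<parallel>\<^sup>2\<close>, which forces \<open>N f = f\<close>. Thus \<open>g = 0\<close>, and then \<open>f = 0\<close>.

  The link between \<open>B\<close> and the moments of \<open>\<mu>\<close> is the coefficient form of
  \<open>(1 - B) H = 1 + B = H (1 - B)\<close> (\<open>nc_herglotz_conv\<close>). A coefficient at a word \<open>\<delta>\<close> is found by evaluating
  at a nilpotent tuple of weighted matrix units placed along \<open>\<delta>\<close>, where all power series are finite
  and become upper triangular matrices of coefficients at the subwords of \<open>\<delta>\<close>.
\<close>

section \<open>The Hilbert space of square-summable functions\<close>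

lemma ell2_summable: "(\<lambda>x. (cmod (ell2_fun f x))\<^sup>2) summable_on A"
  by (rule summable_on_subset_banach[OF _ subset_UNIV]) (use ell2_fun[of f] in simp)

lemma sum_coeff_le_norm:
  assumes "finite F"
  shows "(\<Sum>x\<in>F. (cmod (ell2_fun f x))\<^sup>2) \<le> (norm f)\<^sup>2"
  unfolding norm_ell2_square
  by (rule finite_sum_le_infsum) (use assms ell2_summable in auto)

lemma coeff_le_norm: "cmod (ell2_fun f x) \<le> norm f"
  using sum_coeff_le_norm[of "{x}" f] by (simp add: abs_le_square_iff[symmetric])

lemma ell2_of_bounded_sums:
  fixes f :: "'a \<Rightarrow> complex"
  assumes "\<And>F. finite F \<Longrightarrow> (\<Sum>x\<in>F. (cmod (f x))\<^sup>2) \<le> K"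
  obtains g where "ell2_fun g = f" "(norm g)\<^sup>2 \<le> K"
proof
  have s: "(\<lambda>x. (cmod (f x))\<^sup>2) summable_on UNIV"
    by (rule nonneg_bounded_partial_sums_imp_summable_on[of _ _ K]) (use assms in auto)
  then show *: "ell2_fun (Ell2 f) = f" by (simp add: Ell2_inverse)
  show "(norm (Ell2 f))\<^sup>2 \<le> K"
    unfolding norm_ell2_square * by (rule infsum_le_finite_sums) (use s assms in auto)
qed

text \<open>A Cauchy sequence converges coefficientwise; the Cauchy bounds pass to the limit in every finite
  partial sum and thereby in norm.\<close>

instance ell2 :: (type) complete_space
proof
  fix X :: "nat \<Rightarrow> 'a ell2"
  assume X: "Cauchy X"
  have coeff: "cmod (ell2_fun (X m) a - ell2_fun (X n) a) \<le> norm (X m - X n)" for m n a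
    using coeff_le_norm[of "X m - X n" a] by (simp add: minus_ell2.rep_eq)
  have "Cauchy (\<lambda>n. ell2_fun (X n) a)" for a
  proof (rule metric_CauchyI)
    fix e :: real assume "0 < e"
    from metric_CauchyD[OF X this] show "\<exists>M. \<forall>m\<ge>M. \<forall>n\<ge>M. dist (ell2_fun (X m) a) (ell2_fun (X n) a) < e"
      unfolding dist_norm using coeff le_less_trans by blast
  qed
  then have "\<forall>a. \<exists>l. (\<lambda>n. ell2_fun (X n) a) \<longlonglongrightarrow> l"
    using Cauchy_convergent convergent_def by blast
  then obtain l where l: "\<And>a. (\<lambda>n. ell2_fun (X n) a) \<longlonglongrightarrow> l a" by metis
  \<comment> \<open>For fixed \<open>n\<close>, letting \<open>m \<rightarrow> \<infinity>\<close> in a finite partial sum of \<open>X m - X n\<close>.\<close>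
  have tail: "(\<Sum>a\<in>F. (cmod (l a - ell2_fun (X n) a))\<^sup>2) \<le> e\<^sup>2"
    if e: "\<And>m. m \<ge> n \<Longrightarrow> norm (X m - X n) \<le> e" and F: "finite F" for n e F
  proof (rule LIMSEQ_le_const2)
    show "(\<lambda>m. \<Sum>a\<in>F. (cmod (ell2_fun (X m) a - ell2_fun (X n) a))\<^sup>2)
        \<longlonglongrightarrow> (\<Sum>a\<in>F. (cmod (l a - ell2_fun (X n) a))\<^sup>2)"
      by (intro tendsto_intros l)
    have "(\<Sum>a\<in>F. (cmod (ell2_fun (X m) a - ell2_fun (X n) a))\<^sup>2) \<le> e\<^sup>2" if "m \<ge> n" for m
    proof -
      have "(\<Sum>a\<in>F. (cmod (ell2_fun (X m - X n) a))\<^sup>2) \<le> (norm (X m - X n))\<^sup>2"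
        by (rule sum_coeff_le_norm[OF F])
      also have "\<dots> \<le> e\<^sup>2" using e[OF that] by (simp add: power_mono)
      finally show ?thesis by (simp add: minus_ell2.rep_eq)
    qed
    then show "\<exists>N. \<forall>m\<ge>N. (\<Sum>a\<in>F. (cmod (ell2_fun (X m) a - ell2_fun (X n) a))\<^sup>2) \<le> e\<^sup>2" by blast
  qed
  have ev: "\<exists>n. \<forall>m\<ge>n. \<forall>k\<ge>n. norm (X m - X k) \<le> e" if "e > 0" for e
    using metric_CauchyD[OF X that] unfolding dist_norm by (meson less_imp_le)
  obtain n0 where n0: "\<And>m. m \<ge> n0 \<Longrightarrow> norm (X m - X n0) \<le> 1" using ev[of 1] by auto
  obtain g where g: "ell2_fun g = (\<lambda>a. l a - ell2_fun (X n0) a)"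
    using ell2_of_bounded_sums[OF tail[of n0 1]] n0 by (metis (no_types, lifting))
  define y where "y = g + X n0"
  have y: "ell2_fun y = l" by (auto simp: y_def plus_ell2.rep_eq g)
  have "X \<longlonglongrightarrow> y"
  proof (rule metric_LIMSEQ_I)
    fix e :: real assume "0 < e"
    then obtain N where N: "\<And>m k. m \<ge> N \<Longrightarrow> k \<ge> N \<Longrightarrow> norm (X m - X k) \<le> e / 2"
      using ev[of "e / 2"] by auto
    have "dist (X n) y < e" if "n \<ge> N" for n
    proof -
      have *: "norm (X m - X n) \<le> e / 2" if "m \<ge> n" for m
        using N[of m n] that \<open>n \<ge> N\<close> by linarith
      obtain h where h: "ell2_fun h = (\<lambda>a. l a - ell2_fun (X n) a)" "(norm h)\<^sup>2 \<le> (e / 2)\<^sup>2"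
        by (rule ell2_of_bounded_sums[OF tail[OF *]])
      have "y - X n = h"
        by (simp add: ell2_fun_inject[symmetric] minus_ell2.rep_eq y h)
      moreover have "norm h \<le> e / 2" using h(2) \<open>0 < e\<close> by (simp add: power2_le_iff_abs_le)
      ultimately show ?thesis using \<open>0 < e\<close> by (simp add: dist_norm norm_minus_commute)
    qed
    then show "\<exists>N. \<forall>n\<ge>N. dist (X n) y < e" by blast
  qed
  then show "convergent X" by (auto simp: convergent_def)
qed

lemma cinner_zero [simp]: "cinner 0 f = 0" "cinner f 0 = 0"
  by (transfer; simp)+

lemma cinner_minus_left [simp]: "cinner (- f) g = - cinner f g"
  by transfer (simp add: infsum_uminus)

lemma cinner_minus_right [simp]: "cinner f (- g) = - cinner f g"
  by transfer (simp add: infsum_uminus)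

lemma cinner_diff_left: "cinner (f - g) h = cinner f h - cinner g h"
  using cinner_add_left[of f "- g" h] by simp

lemma cinner_diff_right: "cinner h (f - g) = cinner h f - cinner h g"
  using cinner_add_right[of h f "- g"] by simp

lemma cinner_self_norm: "cinner f f = of_real ((norm f)\<^sup>2)"
  by (simp add: cinner_self norm_ell2_square)

lemma cinner_ket_left: "cinner (ket a) f = ell2_fun f a"
proof -
  have "((\<lambda>x. cnj (ell2_fun (ket a) x) * ell2_fun f x) has_sum ell2_fun f a) {a}"
    by (rule has_sum_finiteI) (auto simp: ket.rep_eq)
  then have "((\<lambda>x. cnj (ell2_fun (ket a) x) * ell2_fun f x) has_sum ell2_fun f a) UNIV"
    by (subst has_sum_cong_neutral[where T = "{a}"]) (auto simp: ket.rep_eq)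
  then show ?thesis unfolding cinner.rep_eq by (rule infsumI)
qed

lemma cinner_ket_right: "cinner f (ket a) = cnj (ell2_fun f a)"
  using cinner_ket_left[of a f] cinner_commute[of f "ket a"] by simp

lemma cscale_0 [simp]: "cscale 0 f = 0" "cscale c 0 = 0"
  by (transfer; simp)+

lemma cscale_1 [simp]: "cscale 1 f = f"
  by transfer simp

lemma cscale_add_right: "cscale c (f + g) = cscale c f + cscale c g"
  by transfer (simp add: distrib_left)

lemma cscale_cscale [simp]: "cscale c (cscale d f) = cscale (c * d) f"
  by transfer (simp add: mult.assoc)

lemma cscale_minus1: "cscale (-1) f = - f"
  by transfer simp

lemma norm_ket [simp]: "norm (ket a) = 1"
proof -
  have "(of_real ((norm (ket a))\<^sup>2) :: complex) = 1"
    unfolding cinner_self_norm[symmetric] cinner_ket_left by (simp add: ket.rep_eq)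
  then have "(norm (ket a))\<^sup>2 = 1" using of_real_eq_1_iff by blast
  then have "norm (ket a) = 1 \<or> norm (ket a) = - 1" by (simp only: power2_eq_1_iff)
  then show ?thesis using norm_ge_zero[of "ket a"] by linarith
qed

lemma norm_cinner_le: "cmod (cinner f g) \<le> norm f * norm g"
proof (cases "cinner f g = 0")
  case False
  \<comment> \<open>Rotating \<open>g\<close> by this phase makes the complex inner product real, so that the real Cauchy--Schwarz inequality applies.\<close>
  define c where "c = cnj (cinner f g) / cmod (cinner f g)"
  have c: "cmod c = 1" using False by (simp add: c_def norm_divide)
  have "cinner f (cscale c g) = of_real (cmod (cinner f g))"
    using False by (simp add: cinner_cscale_right c_def complex_norm_square[symmetric]
      power2_eq_square flip: of_real_mult)
      (metis mult.commute complex_norm_square nonzero_mult_div_cancel_left norm_eq_zero of_real_eq_0_iff of_real_mult power2_eq_square times_divide_eq_left)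
  then have "cmod (cinner f g) = inner f (cscale c g)" by (simp add: inner_ell2_def)
  also have "\<dots> \<le> norm f * norm (cscale c g)" by (rule norm_cauchy_schwarz)
  finally show ?thesis by (simp add: norm_cscale c)
qed simp

lemma bounded_bilinear_cinner: "bounded_bilinear cinner"
  by standard (auto simp: cinner_add_left cinner_add_right scaleR_cscale cinner_cscale_left
      cinner_cscale_right scaleR_conv_of_real intro!: exI[of _ 1] norm_cinner_le)

lemmas continuous_on_cinner [continuous_intros] =
  bounded_bilinear.continuous_on[OF bounded_bilinear_cinner]

lemma continuous_on_cscale [continuous_intros]:
  "continuous_on A f \<Longrightarrow> continuous_on A (\<lambda>x. cscale c (f x))"
  using bounded_linear.continuous_on[OF blinfun.bounded_linear_right[of "scale_op c"]]
  by (simp add: scale_op.rep_eq)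

lemma continuous_on_coeff [continuous_intros]:
  assumes "continuous_on A f" shows "continuous_on A (\<lambda>x. ell2_fun (f x) a)"
  unfolding cinner_ket_left[symmetric] by (intro continuous_intros assms)

text \<open>Density of the finitely supported vectors, as an induction rule: a closed complex subspace that
  contains the standard basis is everything, because truncation to large finite sets converges.\<close>

lemma ell2_induct_closed:
  fixes V :: "'a ell2 set"
  assumes cl: "closed V" and ket: "\<And>a. ket a \<in> V"
    and add: "\<And>f g. f \<in> V \<Longrightarrow> g \<in> V \<Longrightarrow> f + g \<in> V"
    and scale: "\<And>c f. f \<in> V \<Longrightarrow> cscale c f \<in> V"
  shows "f \<in> V"
proof -
  let ?p = "\<lambda>F. \<Sum>a\<in>F. cscale (ell2_fun f a) (ket a)"
  have zero: "0 \<in> V" using scale[OF ket, of 0 undefined] by simp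
  have p: "?p F \<in> V" if "finite F" for F
    using that by induction (auto intro: zero add scale ket)
  have coeff: "ell2_fun (?p F) b = (if b \<in> F then ell2_fun f b else 0)" if "finite F" for F b
    using that by induction (auto simp: zero_ell2.rep_eq plus_ell2.rep_eq cscale.rep_eq ket.rep_eq)
  have "\<exists>g\<in>V. dist g f < e" if e: "e > 0" for e
  proof -
    have "((\<lambda>x. (cmod (ell2_fun f x))\<^sup>2) has_sum (norm f)\<^sup>2) UNIV"
      unfolding norm_ell2_square by (rule has_sum_infsum[OF ell2_summable])
    then obtain F where F: "finite F" "dist (\<Sum>x\<in>F. (cmod (ell2_fun f x))\<^sup>2) ((norm f)\<^sup>2) < e\<^sup>2"
      using e unfolding has_sum_def tendsto_iff eventually_finite_subsets_at_top
      by (metis subset_UNIV order_refl zero_less_power)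
    have "(norm (f - ?p F))\<^sup>2 = (\<Sum>\<^sub>\<infinity>x\<in>UNIV - F. (cmod (ell2_fun f x))\<^sup>2)"
      unfolding norm_ell2_square
      by (rule infsum_cong_neutral) (auto simp: minus_ell2.rep_eq coeff[OF F(1)])
    also have "\<dots> = (norm f)\<^sup>2 - (\<Sum>x\<in>F. (cmod (ell2_fun f x))\<^sup>2)"
      unfolding norm_ell2_square using F(1)
      by (subst infsum_Diff) (auto intro: ell2_summable)
    also have "\<dots> < e\<^sup>2" using F(2) by (simp add: dist_real_def abs_less_iff)
    finally have "norm (f - ?p F) < e" using e by (simp add: power2_less_imp_less)
    then show ?thesis using p[OF F(1)] by (metis dist_commute dist_norm)
  qed
  then have "f \<in> closure V" by (simp add: closure_approachable)
  then show ?thesis using cl by simp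
qed

text \<open>The projection theorem, for the closure of a subspace: by the parallelogram law a sequence in
  \<open>K\<close> that minimizes the distance to \<open>z\<close> is Cauchy, and perturbing its limit \<open>y\<close> along \<open>k \<in> K\<close> would
  bring it closer to \<open>z\<close> unless \<open>z - y\<close> were orthogonal to \<open>k\<close>.\<close>

lemma nearest_point_orthogonal:
  fixes K :: "'a::{real_inner,complete_space} set"
  assumes K: "Real_Vector_Spaces.subspace K"
  obtains y where "y \<in> closure K" "\<And>k. k \<in> K \<Longrightarrow> inner (z - y) k = 0"
proof -
  define D where "D = (INF k\<in>K. (norm (z - k))\<^sup>2)"
  have K0: "K \<noteq> {}" using real_vector.subspace_0[OF K] by auto
  have bdd: "bdd_below ((\<lambda>k. (norm (z - k))\<^sup>2) ` K)" by (rule bdd_belowI[of _ 0]) auto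
  have D: "D \<le> (norm (z - k))\<^sup>2" if "k \<in> K" for k
    unfolding D_def using bdd that by (rule cINF_lower)
  have "\<exists>k\<in>K. (norm (z - k))\<^sup>2 < D + inverse (real (Suc n))" for n
    using cINF_less_iff[OF K0 bdd, of "D + inverse (real (Suc n))"] unfolding D_def by simp
  then obtain X where X: "\<And>n. X n \<in> K" "\<And>n. (norm (z - X n))\<^sup>2 < D + inverse (real (Suc n))"
    by metis
  have par: "(norm (X m - X n))\<^sup>2 \<le> 2 * inverse (real (Suc m)) + 2 * inverse (real (Suc n))" for m n
  proof -
    have mid: "(1/2) *\<^sub>R (X m + X n) \<in> K"
      using K X by (intro real_vector.subspace_scale real_vector.subspace_add) auto
    have "(norm (X m - X n))\<^sup>2 + 4 * (norm (z - (1/2) *\<^sub>R (X m + X n)))\<^sup>2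
        = 2 * (norm (z - X m))\<^sup>2 + 2 * (norm (z - X n))\<^sup>2"
      by (simp add: power2_norm_eq_inner inner_simps inner_commute algebra_simps)
    then show ?thesis using D[OF mid] X(2)[of m] X(2)[of n] by linarith
  qed
  have "Cauchy X"
  proof (rule metric_CauchyI)
    fix e :: real assume e: "0 < e"
    then obtain N where N: "inverse (real (Suc N)) < e\<^sup>2 / 4"
      using reals_Archimedean[of "e\<^sup>2 / 4"] by auto
    have "dist (X m) (X n) < e" if "m \<ge> N" "n \<ge> N" for m n
    proof -
      have "inverse (real (Suc m)) \<le> inverse (real (Suc N))" "inverse (real (Suc n)) \<le> inverse (real (Suc N))"
        using that by (auto intro!: le_imp_inverse_le)
      then have "(norm (X m - X n))\<^sup>2 < e\<^sup>2" using par[of m n] N by linarith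
      then show ?thesis using e by (simp add: dist_norm power2_less_imp_less)
    qed
    then show "\<exists>M. \<forall>m\<ge>M. \<forall>n\<ge>M. dist (X m) (X n) < e" by blast
  qed
  then obtain y where y: "X \<longlonglongrightarrow> y" using Cauchy_convergent convergent_def by blast
  have ycl: "y \<in> closure K" using X(1) y closure_sequential by blast
  have "(\<lambda>n. (norm (z - X n))\<^sup>2) \<longlonglongrightarrow> (norm (z - y))\<^sup>2" by (intro tendsto_intros y)
  moreover have "(\<lambda>n. D + inverse (real (Suc n))) \<longlonglongrightarrow> D + 0"
    by (intro tendsto_intros LIMSEQ_inverse_real_of_nat)
  ultimately have yD: "(norm (z - y))\<^sup>2 \<le> D"
    using LIMSEQ_le X(2) by (metis (no_types, lifting) add.right_neutral less_imp_le)
  have "D \<le> (norm (z - w))\<^sup>2" if w: "w \<in> closure K" for w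
  proof -
    obtain W where W: "\<And>n. W n \<in> K" "W \<longlonglongrightarrow> w" using w closure_sequential by blast
    have "(\<lambda>n. (norm (z - W n))\<^sup>2) \<longlonglongrightarrow> (norm (z - w))\<^sup>2" by (intro tendsto_intros W)
    then show ?thesis by (rule LIMSEQ_le_const) (use D W in auto)
  qed
  note Dcl = this
  have "inner (z - y) k = 0" if k: "k \<in> K" for k
  proof (rule ccontr)
    assume nz: "inner (z - y) k \<noteq> 0"
    \<comment> \<open>The minimizer of the quadratic polynomial \<open>t \<mapsto> \<parallel>z - y - t k\<parallel>\<^sup>2\<close>.\<close>
    define t where "t = inner (z - y) k / (norm k)\<^sup>2"
    have k0: "norm k \<noteq> 0" using nz by auto
    have "y + t *\<^sub>R k \<in> closure K"
    proof -
      have "X n + t *\<^sub>R k \<in> K" for n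
        using K X(1) k by (intro real_vector.subspace_add real_vector.subspace_scale)
      moreover have "(\<lambda>n. X n + t *\<^sub>R k) \<longlonglongrightarrow> y + t *\<^sub>R k" by (intro tendsto_intros y)
      ultimately show ?thesis unfolding closure_sequential by (intro exI[of _ "\<lambda>n. X n + t *\<^sub>R k"]) simp
    qed
    then have "D \<le> (norm (z - (y + t *\<^sub>R k)))\<^sup>2" by (rule Dcl)
    also have "\<dots> = (norm (z - y))\<^sup>2 - 2 * t * inner (z - y) k + t\<^sup>2 * (norm k)\<^sup>2"
      unfolding power2_norm_eq_inner
      by (simp add: inner_simps inner_commute algebra_simps power2_eq_square)
    also have "\<dots> = (norm (z - y))\<^sup>2 - (inner (z - y) k)\<^sup>2 / (norm k)\<^sup>2"
      using k0 by (simp add: t_def field_simps power2_eq_square)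
    also have "\<dots> < (norm (z - y))\<^sup>2" using nz k0 by simp
    finally show False using yD by simp
  qed
  with ycl show thesis by (rule that)
qed

section \<open>Convolution of functions on words\<close>

text \<open>The product of formal power series in non-commuting variables, on coefficient families.\<close>

definition conv :: "('d list \<Rightarrow> complex) \<Rightarrow> ('d list \<Rightarrow> complex) \<Rightarrow> 'd list \<Rightarrow> complex"
  where "conv f g \<gamma> = (\<Sum>i\<le>length \<gamma>. f (take i \<gamma>) * g (drop i \<gamma>))"

lemma conv_Nil [simp]: "conv f g [] = f [] * g []"
  by (simp add: conv_def)

lemma conv_Cons: "conv f g (k # \<gamma>) = f [] * g (k # \<gamma>) + conv (\<lambda>\<beta>. f (k # \<beta>)) g \<gamma>"
  by (simp add: conv_def sum.atMost_Suc_shift del: sum.atMost_Suc)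

lemma conv_add_left: "conv (\<lambda>\<beta>. f \<beta> + f' \<beta>) g \<gamma> = conv f g \<gamma> + conv f' g \<gamma>"
  by (simp add: conv_def distrib_right sum.distrib)

lemma conv_add_right: "conv f (\<lambda>\<beta>. g \<beta> + g' \<beta>) \<gamma> = conv f g \<gamma> + conv f g' \<gamma>"
  by (simp add: conv_def distrib_left sum.distrib)

lemma conv_scale_left: "conv (\<lambda>\<beta>. c * f \<beta>) g \<gamma> = c * conv f g \<gamma>"
  by (simp add: conv_def sum_distrib_left mult.assoc)

lemma conv_scale_right: "conv f (\<lambda>\<beta>. c * g \<beta>) \<gamma> = c * conv f g \<gamma>"
  by (simp add: conv_def sum_distrib_left mult.left_commute)

lemma conv_zero_left [simp]: "conv (\<lambda>_. 0) g \<gamma> = 0"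
  by (simp add: conv_def)

abbreviation unit_series :: "'d list \<Rightarrow> complex" where
  "unit_series \<equiv> \<lambda>\<gamma>. if \<gamma> = [] then 1 else 0"

lemma conv_unit_left [simp]: "conv unit_series f \<gamma> = f \<gamma>"
  by (cases \<gamma>) (simp_all add: conv_Cons)

lemma conv_unit_right [simp]: "conv f unit_series \<gamma> = f \<gamma>"
  by (induction \<gamma> arbitrary: f) (simp_all add: conv_Cons)

lemma conv_diff_left: "conv (\<lambda>\<beta>. f \<beta> - f' \<beta>) g \<gamma> = conv f g \<gamma> - conv f' g \<gamma>"
  by (simp add: conv_def left_diff_distrib sum_subtractf)

lemma conv_diff_right: "conv f (\<lambda>\<beta>. g \<beta> - g' \<beta>) \<gamma> = conv f g \<gamma> - conv f g' \<gamma>"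
  by (simp add: conv_def right_diff_distrib sum_subtractf)

lemma conv_assoc: "conv (conv f g) h \<gamma> = conv f (conv g h) \<gamma>"
proof (induction \<gamma> arbitrary: f)
  case (Cons k \<gamma>)
  have "conv (conv f g) h (k # \<gamma>)
      = f [] * g [] * h (k # \<gamma>) + conv (\<lambda>\<beta>. f [] * g (k # \<beta>) + conv (\<lambda>\<beta>. f (k # \<beta>)) g \<beta>) h \<gamma>"
    by (simp add: conv_Cons)
  also have "\<dots> = conv f (conv g h) (k # \<gamma>)"
    by (simp add: conv_add_left conv_scale_left Cons.IH conv_Cons[of f] conv_Cons[of g] algebra_simps)
  finally show ?case .
qed simp

text \<open>Reversal of words is an anti-automorphism of the power series. This is what exchanges left
  multiplication \<open>B(L)\<close> and right multiplication \<open>B(R)\<close>.\<close>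

lemma conv_rev: "conv f g (rev \<gamma>) = conv (\<lambda>\<beta>. g (rev \<beta>)) (\<lambda>\<beta>. f (rev \<beta>)) \<gamma>"
  unfolding conv_def
  by (rule sum.reindex_bij_witness[of _ "\<lambda>i. length \<gamma> - i" "\<lambda>i. length \<gamma> - i"])
     (auto simp: take_rev drop_rev mult.commute)

section \<open>Adjoints of complex-linear operators\<close>

definition complex_linear_op :: "'a operator \<Rightarrow> bool"
  where "complex_linear_op T \<longleftrightarrow> (\<forall>c f. T (cscale c f) = cscale c (T f))"

lemma complex_linear_opD: "complex_linear_op T \<Longrightarrow> T (cscale c f) = cscale c (T f)"
  by (simp add: complex_linear_op_def)

lemma adj_unique:
  fixes S T :: "'a operator"
  assumes "\<And>f g. cinner (T f) g = cinner f (S g)"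
  shows "adj T = S"
  unfolding adj_def
proof (rule the_equality)
  fix S' :: "'a operator" assume "\<forall>f g. cinner (T f) g = cinner f (S' g)"
  then have "cinner (ket a) (S' g) = cinner (ket a) (S g)" for a g
    using assms by metis
  then show "S' = S"
    by (intro blinfun_eqI) (simp add: cinner_ket_left fun_eq_iff flip: ell2_fun_inject)
qed (use assms in auto)

text \<open>The coefficients of \<open>S g\<close> can only be \<open>\<langle>T e\<^sub>a, g\<rangle>\<close>. They are square-summable: testing \<open>g\<close>
  against \<open>T w\<close>, for \<open>w\<close> the finite sum of the \<open>s\<^sub>a e\<^sub>a\<close>, gives
  \<open>\<parallel>w\<parallel>\<^sup>2 \<le> \<parallel>T\<parallel> \<parallel>g\<parallel> \<parallel>w\<parallel>\<close>. Complex linearity then extends the adjoint relation from the basis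
  to its closed span.\<close>

lemma adjoint_exists:
  assumes T: "complex_linear_op T"
  shows "\<exists>S :: 'a operator. \<forall>f g. cinner (T f) g = cinner f (S g)"
proof -
  have "\<exists>s. ell2_fun s = (\<lambda>a. cinner (T (ket a)) g) \<and> (norm s)\<^sup>2 \<le> (norm T * norm g)\<^sup>2" for g
  proof -
    have bound: "(\<Sum>a\<in>F. (cmod (cinner (T (ket a)) g))\<^sup>2) \<le> (norm T * norm g)\<^sup>2"
      if F: "finite F" for F
    proof -
      define s where "s a = cinner (T (ket a)) g" for a
      define w where "w F = (\<Sum>a\<in>F. cscale (s a) (ket a))" for F
      define \<Sigma> where "\<Sigma> = (\<Sum>a\<in>F. (cmod (s a))\<^sup>2)"
      have wc: "ell2_fun (w F) b = (if b \<in> F then s b else 0)" for b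
        using F unfolding w_def
        by induction (auto simp: zero_ell2.rep_eq plus_ell2.rep_eq cscale.rep_eq ket.rep_eq)
      have sq: "cnj z * z = of_real ((cmod z)\<^sup>2)" for z
        by (metis complex_norm_square mult.commute)
      have "cinner (T (w F)) g = of_real \<Sigma>"
        using F unfolding w_def \<Sigma>_def
        by induction (auto simp: blinfun.add_right complex_linear_opD[OF T] cinner_add_left
            cinner_cscale_left s_def[symmetric] sq simp del: of_real_power)
      then have "\<Sigma> \<le> norm (T (w F)) * norm g"
        using norm_cinner_le[of "T (w F)" g] by simp
      also have "\<dots> \<le> norm T * norm (w F) * norm g"
        by (intro mult_right_mono norm_blinfun norm_ge_zero)
      finally have 1: "\<Sigma> \<le> norm T * norm g * norm (w F)" by (simp add: ac_simps)
      have 2: "(norm (w F))\<^sup>2 = \<Sigma>"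
        unfolding norm_ell2_square \<Sigma>_def using F
        by (subst infsum_cong_neutral[where T = F and g = "\<lambda>a. (cmod (s a))\<^sup>2"]) (auto simp: wc)
      have "norm (w F) \<le> norm T * norm g"
      proof (cases "norm (w F) = 0")
        case False
        then show ?thesis using 1 unfolding 2[symmetric] by (simp add: power2_eq_square)
      qed simp
      then show ?thesis
        using 2 unfolding \<Sigma>_def s_def by (metis norm_ge_zero power_mono)
    qed
    show ?thesis by (rule ell2_of_bounded_sums[OF bound]) auto
  qed
  then obtain s where s: "\<And>g. ell2_fun (s g) = (\<lambda>a. cinner (T (ket a)) g)"
      "\<And>g. (norm (s g))\<^sup>2 \<le> (norm T * norm g)\<^sup>2" by metis
  have "bounded_linear s"
  proof (rule bounded_linear_intro)
    show "s (x + y) = s x + s y" for x y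
      by (simp add: plus_ell2.rep_eq s cinner_add_right flip: ell2_fun_inject)
    show "s (r *\<^sub>R x) = r *\<^sub>R s x" for r x
      by (simp add: s scaleR_cscale cscale.rep_eq cinner_cscale_right flip: ell2_fun_inject)
    show "norm (s x) \<le> norm x * norm T" for x
      using s(2)[of x] by (simp add: power2_le_iff_abs_le mult.commute)
  qed
  then have S: "blinfun_apply (Blinfun s) = s" by (rule bounded_linear_Blinfun_apply)
  have "cinner (T f) g = cinner f (s g)" for f g
  proof -
    have "f \<in> {f. cinner (T f) g = cinner f (s g)}"
    proof (rule ell2_induct_closed)
      show "closed {f. cinner (T f) g = cinner f (s g)}"
        by (intro closed_Collect_eq continuous_intros)
    qed (auto simp: cinner_ket_left s blinfun.add_right complex_linear_opD[OF T]
        cinner_add_left cinner_cscale_left)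
    then show ?thesis by simp
  qed
  then show ?thesis using S by metis
qed

lemma cinner_adj_right:
  assumes "complex_linear_op T" shows "cinner (T f) g = cinner f (adj T g)"
  using adjoint_exists[OF assms] adj_unique by blast

lemma cinner_adj_left:
  assumes "complex_linear_op T" shows "cinner f (T g) = cinner (adj T f) g"
  using cinner_adj_right[OF assms, of g f] cinner_commute by metis

lemma cinner_eqI:
  assumes "\<And>h. cinner h f = cinner h g" shows "f = g"
  using assms[of "ket _"] by (simp add: cinner_ket_left fun_eq_iff flip: ell2_fun_inject)

lemma complex_linear_op_adj: "complex_linear_op T \<Longrightarrow> complex_linear_op (adj T)"
  unfolding complex_linear_op_def[of "adj T"]
  by (intro allI cinner_eqI) (simp add: cinner_cscale_right flip: cinner_adj_right)

lemma complex_linear_op_add: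
  "complex_linear_op S \<Longrightarrow> complex_linear_op T \<Longrightarrow> complex_linear_op (S + T)"
  by (simp add: complex_linear_op_def blinfun.add_left cscale_add_right)

lemma complex_linear_op_compose:
  "complex_linear_op S \<Longrightarrow> complex_linear_op T \<Longrightarrow> complex_linear_op (S o\<^sub>L T)"
  by (simp add: complex_linear_op_def)

lemma complex_linear_op_scale [simp]: "complex_linear_op (scale_op c)"
  by (simp add: complex_linear_op_def scale_op.rep_eq mult.commute)

lemma complex_linear_op_lshift [simp]: "complex_linear_op (lshift k)"
  unfolding complex_linear_op_def
proof (intro allI)
  fix c f
  have "prepend_coeff k (\<lambda>x. c * ell2_fun f x) \<beta> = c * prepend_coeff k (ell2_fun f) \<beta>" for \<beta>
    by (cases \<beta>) auto
  then show "lshift k (cscale c f) = cscale c (lshift k f)"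
    by (simp add: lshift.rep_eq lshift_fun.rep_eq cscale.rep_eq fun_eq_iff flip: ell2_fun_inject)
qed

lemma scale_op_minus1: "scale_op (-1) o\<^sub>L T = - T"
  by (rule blinfun_eqI) (simp add: scale_op.rep_eq cscale_minus1 blinfun.minus_left)

lemma adj_add:
  assumes "complex_linear_op S" "complex_linear_op T"
  shows "adj (S + T) = adj S + adj T"
  by (rule adj_unique)
    (simp add: blinfun.add_left cinner_add_left cinner_add_right cinner_adj_right assms)

lemma adj_scale:
  assumes "complex_linear_op T"
  shows "adj (scale_op c o\<^sub>L T) = scale_op (cnj c) o\<^sub>L adj T"
  by (rule adj_unique)
    (simp add: scale_op.rep_eq cinner_cscale_left cinner_cscale_right cinner_adj_right assms)

lemma adj_compose:
  assumes "complex_linear_op S" "complex_linear_op T"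
  shows "adj (S o\<^sub>L T) = adj T o\<^sub>L adj S"
  by (rule adj_unique) (simp add: cinner_adj_right assms)

lemma adj_id [simp]: "adj id_blinfun = id_blinfun"
  by (rule adj_unique) simp

lemma adj_0 [simp]: "adj 0 = 0"
  by (rule adj_unique) simp

lemma adj_diff:
  assumes "complex_linear_op S" "complex_linear_op T"
  shows "adj (S - T) = adj S - adj T"
  by (rule adj_unique)
    (simp add: blinfun.diff_left cinner_diff_left cinner_diff_right cinner_adj_right assms)

lemma complex_linear_op_diff:
  "complex_linear_op S \<Longrightarrow> complex_linear_op T \<Longrightarrow> complex_linear_op (S - T)"
  using complex_linear_op_add[of S "- T"] complex_linear_op_compose[of "scale_op (-1)" T]
  by (simp add: scale_op_minus1)

lemma norm_adj_le:
  assumes "complex_linear_op T" shows "norm (adj T) \<le> norm T"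
proof (rule norm_blinfun_bound)
  fix g
  have "(norm (adj T g))\<^sup>2 = cmod (cinner (T (adj T g)) g)"
    by (simp add: cinner_adj_right assms cinner_self_norm norm_power)
  also have "\<dots> \<le> norm (T (adj T g)) * norm g" by (rule norm_cinner_le)
  also have "\<dots> \<le> norm T * norm (adj T g) * norm g"
    by (intro mult_right_mono norm_blinfun norm_ge_zero)
  finally show "norm (adj T g) \<le> norm T * norm g"
    by (cases "norm (adj T g) = 0") (auto simp: power2_eq_square mult_ac)
qed simp

lemma continuous_on_adj: "continuous_on (Collect complex_linear_op) adj"
proof (rule continuous_onI)
  fix S :: "'a operator" and e :: real
  assume S: "S \<in> Collect complex_linear_op" and e: "0 < e"
  have "dist (adj T) (adj S) \<le> e" if "complex_linear_op T" "dist T S < e" for T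
    using that S norm_adj_le[of "T - S"] complex_linear_op_diff[of T S]
    by (simp add: dist_norm adj_diff)
  then show "\<exists>d>0. \<forall>T\<in>Collect complex_linear_op. dist T S < d \<longrightarrow> dist (adj T) (adj S) \<le> e"
    using e by blast
qed

lemma adj_lshift_coeff: "ell2_fun (adj (lshift k) f) \<gamma> = ell2_fun f (k # \<gamma>)"
  by (simp add: lshift_ket flip: cinner_ket_left cinner_adj_right)

lemma lshift_coeff: "ell2_fun (lshift k f) \<gamma> = prepend_coeff k (ell2_fun f) \<gamma>"
  by (simp add: lshift.rep_eq lshift_fun.rep_eq)

lemma adj_lshift_lshift: "adj (lshift j) o\<^sub>L lshift k = (if j = k then id_blinfun else 0)"
  by (rule blinfun_eqI)
    (auto simp: adj_lshift_coeff lshift_coeff zero_ell2.rep_eq fun_eq_iff simp flip: ell2_fun_inject)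

section \<open>The disk algebra\<close>

lemma image_closure_subset_closed:
  assumes "continuous_on (closure A) f" "closed C" "\<And>x. x \<in> A \<Longrightarrow> f x \<in> C" "x \<in> closure A"
  shows "f x \<in> C"
  using image_closure_subset[OF assms(1,2)] assms(3,4) by blast

lemma closure_add_mem:
  fixes A :: "'b::real_normed_vector set"
  assumes "\<And>x y. x \<in> A \<Longrightarrow> y \<in> A \<Longrightarrow> x + y \<in> A" "x \<in> closure A" "y \<in> closure A"
  shows "x + y \<in> closure A"
proof -
  obtain X Y where "\<And>n. X n \<in> A" "X \<longlonglongrightarrow> x" "\<And>n. Y n \<in> A" "Y \<longlonglongrightarrow> y"
    using assms(2,3) unfolding closure_sequential by blast
  then have "\<And>n. X n + Y n \<in> A" "(\<lambda>n. X n + Y n) \<longlonglongrightarrow> x + y"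
    using assms(1) by (auto intro: tendsto_intros)
  then show ?thesis unfolding closure_sequential by (intro exI[of _ "\<lambda>n. X n + Y n"]) simp
qed

lemma closure_scale_op_mem:
  fixes A :: "'a operator set"
  assumes "\<And>T. T \<in> A \<Longrightarrow> scale_op c o\<^sub>L T \<in> A" "T \<in> closure A"
  shows "scale_op c o\<^sub>L T \<in> closure A"
  by (rule image_closure_subset_closed[where A = A])
    (use assms closure_subset in \<open>auto intro!: continuous_intros\<close>)

lemma closed_complex_linear_op: "closed (Collect complex_linear_op :: 'a operator set)"
  unfolding complex_linear_op_def
  by (intro closed_Collect_all closed_Collect_eq continuous_intros)

lemma free_polys_complex_linear: "T \<in> free_polys \<Longrightarrow> complex_linear_op T"
  by (induction rule: free_polys.induct)
    (auto intro: complex_linear_op_add complex_linear_op_compose)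

lemma disk_algebra_complex_linear: "T \<in> disk_algebra \<Longrightarrow> complex_linear_op T"
  using closure_minimal[OF _ closed_complex_linear_op, of free_polys] free_polys_complex_linear
  unfolding disk_algebra_def by blast

text \<open>An element of the disk algebra is left multiplication by the power series of its value at \<open>1\<close>.
  In particular it is determined by that value, which is what makes \<open>disk_symbol\<close> well defined.\<close>

lemma free_polys_left_mult:
  "T \<in> free_polys \<Longrightarrow> ell2_fun (T f) = conv (ell2_fun (T (ket []))) (ell2_fun f)"
proof (induction arbitrary: f rule: free_polys.induct)
  case (scalar c)
  have "conv (\<lambda>\<beta>. c * (if \<beta> = [] then 1 else 0)) (ell2_fun f) \<gamma> = c * ell2_fun f \<gamma>" for \<gamma>
    by (cases \<gamma>) (simp_all add: conv_Cons)
  then show ?case by (simp add: scale_op.rep_eq cscale.rep_eq ket.rep_eq fun_eq_iff)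
next
  case (shift k)
  have *: "conv (\<lambda>\<beta>. if \<beta> = [] then 1 else 0) g \<gamma> = g \<gamma>" for g :: "'a list \<Rightarrow> complex" and \<gamma>
    by (cases \<gamma>) (simp_all add: conv_Cons)
  have "conv (\<lambda>\<beta>. if \<beta> = [k] then 1 else 0) (ell2_fun f) \<gamma> = prepend_coeff k (ell2_fun f) \<gamma>" for \<gamma>
    by (cases \<gamma>) (auto simp add: conv_Cons * cong: if_cong)
  then show ?case by (simp add: lshift_ket lshift_coeff ket.rep_eq fun_eq_iff)
next
  case (add S T)
  show ?case
    by (simp add: blinfun.add_left plus_ell2.rep_eq conv_add_left add.IH[of f] fun_eq_iff)
next
  case (mult S T)
  show ?case
    by (simp add: mult.IH(1)[of "T f"] mult.IH(1)[of "T (ket [])"] mult.IH(2)[of f]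
        conv_assoc fun_eq_iff)
qed

lemma disk_algebra_left_mult:
  fixes T :: "'d list operator"
  assumes "T \<in> disk_algebra"
  shows "ell2_fun (T f) = conv (ell2_fun (T (ket []))) (ell2_fun f)"
proof -
  have "closed {T :: 'd list operator. \<forall>\<gamma>. ell2_fun (T f) \<gamma> = conv (ell2_fun (T (ket []))) (ell2_fun f) \<gamma>}"
    unfolding conv_def by (intro closed_Collect_all closed_Collect_eq continuous_intros)
  then have "disk_algebra \<subseteq> {T :: 'd list operator. \<forall>\<gamma>. ell2_fun (T f) \<gamma> = conv (ell2_fun (T (ket []))) (ell2_fun f) \<gamma>}"
    unfolding disk_algebra_def by (intro closure_minimal subsetI CollectI allI fun_cong[OF free_polys_left_mult])
  then show ?thesis using assms by auto
qed

lemma disk_symbol_eq: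
  fixes T :: "'d list operator"
  assumes "T \<in> disk_algebra" shows "disk_symbol (T (ket [])) = T"
  unfolding disk_symbol_def
proof (rule the_equality)
  fix S assume "S \<in> disk_algebra \<and> S (ket []) = T (ket [])"
  then have "ell2_fun (S f) = ell2_fun (T f)" for f
    using disk_algebra_left_mult[of S f] disk_algebra_left_mult[OF assms, of f] by metis
  then show "S = T" by (intro blinfun_eqI) (simp add: ell2_fun_inject)
qed (use assms in simp)

lemma free_polys_disk_algebra: "T \<in> free_polys \<Longrightarrow> T \<in> disk_algebra"
  unfolding disk_algebra_def using closure_subset by blast

lemma disk_algebra_0: "(0 :: 'd list operator) \<in> disk_algebra"
proof -
  have "scale_op 0 = (0 :: 'd list operator)" by (rule blinfun_eqI) (simp add: scale_op.rep_eq)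
  moreover have "scale_op 0 \<in> (disk_algebra :: 'd list operator set)"
    by (rule free_polys_disk_algebra[OF free_polys.scalar])
  ultimately show ?thesis by simp
qed

lemma free_polys_id: "(id_blinfun :: 'd list operator) \<in> free_polys"
proof -
  have "scale_op 1 = (id_blinfun :: 'd list operator)" by (rule blinfun_eqI) (simp add: scale_op.rep_eq)
  moreover have "scale_op 1 \<in> (free_polys :: 'd list operator set)" by (rule free_polys.scalar)
  ultimately show ?thesis by simp
qed

lemma disk_algebra_add: "S \<in> disk_algebra \<Longrightarrow> T \<in> disk_algebra \<Longrightarrow> S + T \<in> disk_algebra"
  unfolding disk_algebra_def by (rule closure_add_mem) (auto intro: free_polys.add)

lemma disk_algebra_scale: "T \<in> disk_algebra \<Longrightarrow> scale_op c o\<^sub>L T \<in> disk_algebra"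
  unfolding disk_algebra_def by (rule closure_scale_op_mem) (auto intro: free_polys.intros)

lemma disk_algebra_diff: "S \<in> disk_algebra \<Longrightarrow> T \<in> disk_algebra \<Longrightarrow> S - T \<in> disk_algebra"
  using disk_algebra_add[of S "scale_op (-1) o\<^sub>L T"] disk_algebra_scale[of T "-1"]
  by (simp add: scale_op_minus1)

section \<open>Words in the shifts\<close>

lemma compose_assoc: "(S o\<^sub>L T) o\<^sub>L U = S o\<^sub>L (T o\<^sub>L U)" for S T U :: "'a operator"
  by (rule blinfun_eqI) simp

lemma compose_id [simp]: "T o\<^sub>L id_blinfun = T" "id_blinfun o\<^sub>L T = T" for T :: "'a operator"
  by (rule blinfun_eqI; simp)+

lemma compose_0 [simp]: "T o\<^sub>L 0 = 0" "0 o\<^sub>L T = 0" for T :: "'a operator"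
  by (rule blinfun_eqI; simp add: blinfun.zero_left blinfun.zero_right)+

lemma lshift_word_Nil [simp]: "lshift_word [] = id_blinfun"
  by (simp add: lshift_word_def)

lemma lshift_word_Cons [simp]: "lshift_word (k # \<alpha>) = lshift k o\<^sub>L lshift_word \<alpha>"
  by (simp add: lshift_word_def)

lemma lshift_word_append: "lshift_word (\<alpha> @ \<beta>) = lshift_word \<alpha> o\<^sub>L lshift_word \<beta>"
  by (induction \<alpha>) (auto simp: compose_assoc)

lemma lshift_word_ket: "lshift_word \<alpha> (ket \<beta>) = ket (\<alpha> @ \<beta>)"
  by (induction \<alpha>) (auto simp: lshift_ket)

lemma lshift_word_free_polys: "lshift_word \<alpha> \<in> free_polys"
  by (induction \<alpha>) (auto intro: free_polys.intros free_polys_id)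

lemma complex_linear_op_lshift_word [simp]: "complex_linear_op (lshift_word \<alpha>)"
  by (rule free_polys_complex_linear[OF lshift_word_free_polys])

text \<open>The shifts have orthogonal ranges, so common first letters cancel and different ones annihilate.
  After finitely many cancellations \<open>(L\<^sup>\<alpha>)\<^sup>* L\<^sup>\<beta>\<close> is a word, the adjoint of a word, or \<open>0\<close>.\<close>

lemma adj_lshift_word_lshift_word:
  "adj (lshift_word (j # \<alpha>)) o\<^sub>L lshift_word (k # \<beta>)
    = (if j = k then adj (lshift_word \<alpha>) o\<^sub>L lshift_word \<beta> else 0)"
proof -
  have "adj (lshift_word (j # \<alpha>)) o\<^sub>L lshift_word (k # \<beta>)
      = adj (lshift_word \<alpha>) o\<^sub>L (adj (lshift j) o\<^sub>L lshift k) o\<^sub>L lshift_word \<beta>"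
    by (simp only: lshift_word_Cons adj_compose complex_linear_op_lshift complex_linear_op_lshift_word
        compose_assoc)
  also have "\<dots> = (if j = k then adj (lshift_word \<alpha>) o\<^sub>L lshift_word \<beta> else 0)"
    by (simp only: adj_lshift_lshift split: if_split) simp
  finally show ?thesis .
qed

text \<open>The free polynomials again, but generated linearly from the words. Linear and sesquilinear
  identities can then be proved by induction from their values on words.\<close>

inductive_set word_span :: "'d list operator set" where
  word: "lshift_word \<alpha> \<in> word_span"
| add: "S \<in> word_span \<Longrightarrow> T \<in> word_span \<Longrightarrow> S + T \<in> word_span"
| scale: "T \<in> word_span \<Longrightarrow> scale_op c o\<^sub>L T \<in> word_span"

lemma compose_add_distrib:
  "(S + T) o\<^sub>L U = (S o\<^sub>L U) + (T o\<^sub>L U)" "U o\<^sub>L (S + T) = (U o\<^sub>L S) + (U o\<^sub>L T)"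
  for S T U :: "'a operator"
  by (rule blinfun_eqI; simp add: blinfun.add_left blinfun.add_right)+

lemma compose_scale_op: "complex_linear_op S \<Longrightarrow> S o\<^sub>L (scale_op c o\<^sub>L T) = scale_op c o\<^sub>L (S o\<^sub>L T)"
  by (rule blinfun_eqI) (simp add: scale_op.rep_eq complex_linear_op_def)

lemma word_span_free_polys: "T \<in> word_span \<Longrightarrow> T \<in> free_polys"
  by (induction rule: word_span.induct) (auto intro: free_polys.intros lshift_word_free_polys)

lemma word_span_compose:
  assumes "S \<in> word_span" "T \<in> word_span" shows "S o\<^sub>L T \<in> word_span"
proof -
  have "lshift_word \<alpha> o\<^sub>L T \<in> word_span" for \<alpha>
    using assms(2) by induction
      (auto simp: compose_add_distrib compose_scale_op simp flip: lshift_word_append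
        intro: word_span.intros)
  with assms(1) show ?thesis
    by induction (auto simp: compose_add_distrib compose_assoc intro: word_span.intros)
qed

lemma free_polys_word_span: "T \<in> free_polys \<Longrightarrow> T \<in> word_span"
proof (induction rule: free_polys.induct)
  case (scalar c)
  show ?case using word_span.scale[OF word_span.word[of "[]"], of c] by simp
next
  case (shift k)
  show ?case using word_span.word[of "[k]"] by simp
qed (auto intro: word_span.intros word_span_compose)

section \<open>The disk system\<close>

lemma disk_system_disk_algebra: "T \<in> disk_algebra \<Longrightarrow> T \<in> disk_system"
  unfolding disk_system_def
  by (rule subsetD[OF closure_subset]) (use disk_algebra_0 adj_0 in force)

lemma disk_system_adj_disk_algebra: "T \<in> disk_algebra \<Longrightarrow> adj T \<in> disk_system"
  unfolding disk_system_def
  by (rule subsetD[OF closure_subset]) (use disk_algebra_0 in force)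

lemma scale_op_disk_system: "scale_op c \<in> disk_system"
  by (intro disk_system_disk_algebra free_polys_disk_algebra free_polys.scalar)

lemma disk_system_add: "(S :: 'd list operator) \<in> disk_system \<Longrightarrow> T \<in> disk_system \<Longrightarrow> S + T \<in> disk_system"
  unfolding disk_system_def
proof (rule closure_add_mem, safe)
  fix S T S' T' :: "'d list operator"
  assume *: "S \<in> disk_algebra" "T \<in> disk_algebra" "S' \<in> disk_algebra" "T' \<in> disk_algebra"
  then have "S + adj T + (S' + adj T') = (S + S') + adj (T + T')"
    by (simp add: adj_add disk_algebra_complex_linear)
  then show "\<exists>S'' T''. S + adj T + (S' + adj T') = S'' + adj T'' \<and> S'' \<in> disk_algebra \<and> T'' \<in> disk_algebra"
    using * disk_algebra_add by blast
qed

lemma disk_system_scale: "(T :: 'd list operator) \<in> disk_system \<Longrightarrow> scale_op c o\<^sub>L T \<in> disk_system"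
  unfolding disk_system_def
proof (rule closure_scale_op_mem, safe)
  fix S T :: "'d list operator"
  assume *: "S \<in> disk_algebra" "T \<in> disk_algebra"
  then have "scale_op c o\<^sub>L (S + adj T) = (scale_op c o\<^sub>L S) + adj (scale_op (cnj c) o\<^sub>L T)"
    by (simp add: adj_scale disk_algebra_complex_linear compose_add_distrib)
  then show "\<exists>S' T'. scale_op c o\<^sub>L (S + adj T) = S' + adj T' \<and> S' \<in> disk_algebra \<and> T' \<in> disk_algebra"
    using * disk_algebra_scale by blast
qed

lemma adj_word_word_disk_system: "adj (lshift_word \<alpha>) o\<^sub>L lshift_word \<beta> \<in> disk_system"
proof (induction \<alpha> arbitrary: \<beta>)
  case Nil
  then show ?case by (simp add: disk_system_disk_algebra free_polys_disk_algebra lshift_word_free_polys)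
next
  case (Cons j \<alpha>)
  show ?case
  proof (cases \<beta>)
    case Nil
    then show ?thesis
      using disk_system_adj_disk_algebra[OF free_polys_disk_algebra[OF lshift_word_free_polys]]
      by (metis compose_id lshift_word_Nil)
  next
    case (Cons k \<gamma>)
    then show ?thesis
      by (simp only: adj_lshift_word_lshift_word split: if_split)
        (blast intro: Cons.IH disk_system_disk_algebra disk_algebra_0)
  qed
qed

text \<open>For words this is the cancellation rule; it extends to polynomials by sesquilinearity and to the
  disk algebra because the adjoint and the composition are norm-continuous.\<close>

lemma adj_compose_disk_system:
  fixes S T :: "'d list operator"
  assumes S: "S \<in> disk_algebra" and T: "T \<in> disk_algebra"
  shows "adj S o\<^sub>L T \<in> disk_system"
proof -
  have cl: "closed disk_system" by (simp add: disk_system_def)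
  have word: "adj (lshift_word \<alpha>) o\<^sub>L T \<in> disk_system" if "T \<in> word_span" for \<alpha> and T :: "'d list operator"
    using that
    by induction (simp_all add: compose_add_distrib compose_scale_op complex_linear_op_adj
        adj_word_word_disk_system disk_system_add disk_system_scale)
  have poly: "adj S o\<^sub>L T \<in> disk_system" if "S \<in> word_span" "T \<in> word_span" for S T :: "'d list operator"
    using that(1)
  proof induction
    case (add S S')
    then show ?case
      by (simp add: adj_add word_span_free_polys free_polys_complex_linear compose_add_distrib
          disk_system_add)
  next
    case (scale S c)
    then show ?case
      by (simp add: adj_scale word_span_free_polys free_polys_complex_linear compose_assoc
          disk_system_scale)
  qed (rule word[OF that(2)])
  have mem: "adj S o\<^sub>L T \<in> disk_system" if "S \<in> free_polys" for S
  proof (rule image_closure_subset_closed[where A = free_polys and f = "\<lambda>T. adj S o\<^sub>L T"])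
    show "continuous_on (closure free_polys) (\<lambda>T. adj S o\<^sub>L T)" by (intro continuous_intros)
    show "adj S o\<^sub>L T \<in> disk_system" if "T \<in> free_polys" for T
      using that \<open>S \<in> free_polys\<close> by (intro poly free_polys_word_span)
  qed (use T cl in \<open>simp_all add: disk_algebra_def\<close>)
  have "continuous_on (closure free_polys) (adj :: 'd list operator \<Rightarrow> _)"
    using disk_algebra_complex_linear unfolding disk_algebra_def
    by (intro continuous_on_subset[OF continuous_on_adj]) blast
  then have "continuous_on (closure free_polys) (\<lambda>S. adj S o\<^sub>L T)"
    by (intro continuous_intros)
  then show ?thesis
    by (rule image_closure_subset_closed[where A = free_polys, OF _ cl mem])
      (use S in \<open>simp_all add: disk_algebra_def\<close>)
qed

section \<open>Positive NC measures\<close>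

context
  fixes \<mu> :: "'d list operator \<Rightarrow> complex"
  assumes \<mu>: "positive_nc_measure \<mu>"
begin

lemma nc_measure_add: "S \<in> disk_system \<Longrightarrow> T \<in> disk_system \<Longrightarrow> \<mu> (S + T) = \<mu> S + \<mu> T"
  using \<mu> by (simp add: positive_nc_measure_def)

lemma nc_measure_scale: "T \<in> disk_system \<Longrightarrow> \<mu> (scale_op c o\<^sub>L T) = c * \<mu> T"
  using \<mu> by (simp add: positive_nc_measure_def)

lemma nc_measure_positive: "T \<in> disk_system \<Longrightarrow> positive_op T \<Longrightarrow> \<mu> T \<in> \<real>\<^sub>\<ge>\<^sub>0"
  using \<mu> by (simp add: positive_nc_measure_def)

lemma nc_measure_scale_op: "\<mu> (scale_op c) = c * \<mu> id_blinfun"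
  using nc_measure_scale[OF disk_system_disk_algebra[OF free_polys_disk_algebra[OF free_polys_id]], of c]
  by simp

lemma nc_measure_0: "\<mu> 0 = 0"
proof -
  have "scale_op 0 o\<^sub>L 0 = (0 :: 'd list operator)" by (rule blinfun_eqI) simp
  then show ?thesis
    using nc_measure_scale[OF disk_system_disk_algebra[OF disk_algebra_0], of 0] by simp
qed

lemma nc_measure_gram_nonneg:
  assumes "T \<in> disk_algebra" shows "\<mu> (adj T o\<^sub>L T) \<in> \<real>\<^sub>\<ge>\<^sub>0"
  using assms
  by (intro nc_measure_positive adj_compose_disk_system)
    (auto simp: positive_op_def cinner_self_norm disk_algebra_complex_linear simp flip: cinner_adj_right simp del: of_real_power)

text \<open>The operator \<open>\<parallel>T\<parallel>\<^sup>2 I - T\<^sup>* T\<close> is positive.\<close>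

lemma nc_measure_gram_le:
  assumes T: "T \<in> disk_algebra"
  shows "Re (\<mu> (adj T o\<^sub>L T)) \<le> (norm T)\<^sup>2 * Re (\<mu> id_blinfun)"
proof -
  let ?A = "scale_op (of_real ((norm T)\<^sup>2)) + (scale_op (-1) o\<^sub>L (adj T o\<^sub>L T))"
  note mem = disk_system_disk_algebra[OF free_polys_disk_algebra[OF free_polys_id]]
    adj_compose_disk_system[OF T T]
  have "cinner f (?A f) = of_real ((norm T)\<^sup>2 * (norm f)\<^sup>2 - (norm (T f))\<^sup>2)" for f
    by (simp add: blinfun.add_left scale_op.rep_eq cinner_add_right cinner_cscale_right
        cinner_self_norm disk_algebra_complex_linear T flip: cinner_adj_right)
  moreover have "(norm (T f))\<^sup>2 \<le> (norm T)\<^sup>2 * (norm f)\<^sup>2" for f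
    using power_mono[OF norm_blinfun[of T f] norm_ge_zero, of 2] by (simp add: power_mult_distrib)
  ultimately have "positive_op ?A"
    unfolding positive_op_def by (metis diff_ge_0_iff_ge nonneg_Reals_of_real_iff)
  then have "\<mu> ?A \<in> \<real>\<^sub>\<ge>\<^sub>0"
    by (intro nc_measure_positive disk_system_add disk_system_scale scale_op_disk_system mem)
  moreover have "\<mu> ?A = of_real ((norm T)\<^sup>2) * \<mu> id_blinfun - \<mu> (adj T o\<^sub>L T)"
    by (subst nc_measure_add) (use mem in \<open>simp_all add: disk_system_scale nc_measure_scale nc_measure_scale_op scale_op_disk_system del: of_real_power\<close>)
  ultimately show ?thesis by (simp add: complex_nonneg_Reals_iff)
qed

text \<open>For \<open>c\<close> of modulus one the operator \<open>2 \<parallel>T\<parallel> I + c T + (c T)\<^sup>*\<close> is positive, so \<open>\<mu>\<close> is real on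
  it; the cases \<open>c = 1\<close> and \<open>c = \<i>\<close> give the imaginary and the real part of the claim.\<close>

lemma nc_measure_adj:
  assumes T: "T \<in> disk_algebra" shows "\<mu> (adj T) = cnj (\<mu> T)"
proof -
  note mem = disk_system_disk_algebra[OF free_polys_disk_algebra[OF free_polys_id]]
    disk_system_disk_algebra[OF T] disk_system_adj_disk_algebra[OF T]
  have real: "Im (c * \<mu> T + cnj c * \<mu> (adj T)) = 0" if c: "cmod c = 1" for c
  proof -
    let ?A = "scale_op (of_real (2 * norm T)) + ((scale_op c o\<^sub>L T) + (scale_op (cnj c) o\<^sub>L adj T))"
    have "cinner f (?A f) = of_real (2 * norm T * (norm f)\<^sup>2 + 2 * Re (c * cinner f (T f)))" for f
    proof -
      have "cinner f (adj T f) = cnj (cinner f (T f))"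
        using cinner_adj_right[OF disk_algebra_complex_linear[OF T], of f f] cinner_commute by metis
      then show ?thesis
        by (simp add: blinfun.add_left scale_op.rep_eq cinner_add_right cinner_cscale_right
          cinner_self_norm complex_eq_iff)
    qed
    moreover have "0 \<le> 2 * norm T * (norm f)\<^sup>2 + 2 * Re (c * cinner f (T f))" for f
    proof -
      have "\<bar>Re (c * cinner f (T f))\<bar> \<le> cmod (cinner f (T f))"
        using abs_Re_le_cmod[of "c * cinner f (T f)"] c by (simp add: norm_mult)
      also have "\<dots> \<le> norm f * norm (T f)" by (rule norm_cinner_le)
      also have "\<dots> \<le> norm f * (norm T * norm f)" by (intro mult_left_mono norm_blinfun) simp
      finally show ?thesis by (simp add: power2_eq_square abs_le_iff mult_ac)
    qed
    ultimately have "positive_op ?A"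
      unfolding positive_op_def by (metis nonneg_Reals_of_real_iff)
    then have pos: "\<mu> ?A \<in> \<real>\<^sub>\<ge>\<^sub>0"
      by (intro nc_measure_positive disk_system_add disk_system_scale scale_op_disk_system mem)
    have "positive_op (id_blinfun :: 'd list operator)"
      by (auto simp: positive_op_def cinner_self_norm simp del: of_real_power)
    then have "\<mu> id_blinfun \<in> \<real>\<^sub>\<ge>\<^sub>0" by (rule nc_measure_positive[OF mem(1)])
    then have "Im (\<mu> id_blinfun) = 0" by (simp add: complex_nonneg_Reals_iff)
    moreover have "\<mu> ?A = of_real (2 * norm T) * \<mu> id_blinfun + (c * \<mu> T + cnj c * \<mu> (adj T))"
      using mem by (simp add: nc_measure_add nc_measure_scale nc_measure_scale_op disk_system_add
          disk_system_scale scale_op_disk_system)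
    ultimately show ?thesis using pos by (simp add: complex_nonneg_Reals_iff)
  qed
  from real[of 1] real[of \<i>] show ?thesis by (simp add: complex_eq_iff)
qed

end

section \<open>Vectors attached to an inner symbol\<close>

lemma cinner_lshift_lshift:
  "cinner (lshift j f) (lshift k g) = (if j = k then cinner f g else 0)"
proof -
  have "cinner (lshift j f) (lshift k g) = cinner f ((adj (lshift j) o\<^sub>L lshift k) g)"
    by (simp add: cinner_adj_right)
  then show ?thesis by (simp add: adj_lshift_lshift)
qed

text \<open>Here \<open>N\<close> stands for \<open>B(R)\<close> with \<open>B\<close> inner, \<open>\<beta>\<close> for the coefficients of \<open>B(R) 1\<close>, and
  \<open>c \<gamma>\<close> for \<open>\<mu>((L\<^sup>\<gamma>)\<^sup>*)\<close>, the Cauchy transform of the constant \<open>1\<close>. Up to a constant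
  at the empty word, \<open>2 c\<close> is the Herglotz transform with words reversed, so the last two
  assumptions are the two orders of the relation between a symbol and its Herglotz transform. Their
  right-hand side is the reproducing kernel at the origin of the orthogonal complement of the range
  of \<open>N\<close>, up to a scalar.\<close>

locale inner_kernel =
  fixes N :: "'d list ell2 \<Rightarrow> 'd list ell2" and \<beta> c :: "'d list \<Rightarrow> complex"
  assumes N_coeff: "ell2_fun (N f) \<gamma> = conv (ell2_fun f) \<beta> \<gamma>"
    and N_norm: "norm (N f) = norm f"
    and \<beta>_ne_1: "\<beta> [] \<noteq> 1"
    and conv_c_\<beta>: "c \<gamma> - conv c \<beta> \<gamma>
      = (unit_series \<gamma> - cnj (\<beta> []) * \<beta> \<gamma>) / (1 - cnj (\<beta> []))"
    and conv_\<beta>_c: "c \<gamma> - conv \<beta> c \<gamma>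
      = (unit_series \<gamma> - cnj (\<beta> []) * \<beta> \<gamma>) / (1 - cnj (\<beta> []))"
begin

lemma N_add: "N (f + g) = N f + N g"
  by (simp add: fun_eq_iff N_coeff plus_ell2.rep_eq conv_add_left flip: ell2_fun_inject)

lemma N_cscale: "N (cscale a f) = cscale a (N f)"
  by (simp add: fun_eq_iff N_coeff cscale.rep_eq conv_scale_left flip: ell2_fun_inject)

lemma cinner_N_N: "cinner (N f) (N g) = cinner f g"
proof -
  have re: "Re (cinner (N f) (N g)) = Re (cinner f g)" for f g
  proof -
    have "(norm (N f + N g))\<^sup>2 = (norm (f + g))\<^sup>2" by (simp add: N_norm flip: N_add)
    then have "inner (N f) (N g) = inner f g"
      by (simp add: power2_norm_eq_inner inner_simps inner_commute)
        (simp add: N_norm flip: power2_norm_eq_inner)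
    then show ?thesis by (simp add: inner_ell2_def)
  qed
  from re[of f g] re[of f "cscale \<i> g"] show ?thesis
    by (simp add: N_cscale cinner_cscale_right complex_eq_iff)
qed

lemma N_lshift: "N (lshift k f) = lshift k (N f)"
proof -
  have "conv (prepend_coeff k (ell2_fun f)) \<beta> \<gamma> = prepend_coeff k (conv (ell2_fun f) \<beta>) \<gamma>" for \<gamma>
    by (cases \<gamma>) (simp_all add: conv_Cons)
  then show ?thesis
    by (simp add: lshift.rep_eq lshift_fun.rep_eq N_coeff[abs_def] fun_eq_iff flip: ell2_fun_inject)
qed

lemma N_lshift_word: "N (lshift_word w f) = lshift_word w (N f)"
  by (induction w) (simp_all add: N_lshift)

text \<open>The backward shift of \<open>f B\<^sup>t\<close> removes a letter from \<open>f\<close>, or, at the constant term of \<open>f\<close>,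
  from \<open>B\<^sup>t\<close>.\<close>

lemma adj_lshift_N:
  "adj (lshift k) (N f) = N (adj (lshift k) f) + cscale (ell2_fun f []) (adj (lshift k) (N (ket [])))"
proof -
  have "conv (\<lambda>\<gamma>. if \<gamma> = [] then 1 else 0) \<beta> (k # \<gamma>) = \<beta> (k # \<gamma>)" for \<gamma>
    by (simp add: conv_Cons)
  then show ?thesis
    by (simp add: fun_eq_iff N_coeff adj_lshift_coeff[abs_def] plus_ell2.rep_eq cscale.rep_eq
        conv_Cons[of "ell2_fun f"] ket.rep_eq flip: ell2_fun_inject)
qed

definition Bt where "Bt = N (ket [])"

lemma Bt_coeff: "ell2_fun Bt \<gamma> = \<beta> \<gamma>"
  unfolding Bt_def N_coeff by (cases \<gamma>) (simp_all add: conv_Cons ket.rep_eq)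

definition \<kappa> where "\<kappa> = 1 / (1 - cnj (\<beta> []))"

lemma \<kappa>_mult: "\<kappa> * (1 - cnj (\<beta> [])) = 1" "cnj \<kappa> * (1 - \<beta> []) = 1"
proof -
  have "cnj (\<beta> []) \<noteq> 1" using \<beta>_ne_1 by (metis complex_cnj_cnj complex_cnj_one)
  then show "\<kappa> * (1 - cnj (\<beta> [])) = 1" by (simp add: \<kappa>_def)
  show "cnj \<kappa> * (1 - \<beta> []) = 1" using \<beta>_ne_1 by (simp add: \<kappa>_def)
qed

lemma c_Nil: "c [] = \<kappa> * cnj \<kappa> * (1 - \<beta> [] * cnj (\<beta> []))"
proof -
  have "c [] * (1 - \<beta> []) = (1 - cnj (\<beta> []) * \<beta> []) / (1 - cnj (\<beta> []))"
    using conv_c_\<beta>[of "[]"] by (simp add: right_diff_distrib)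
  then have "c [] * (1 - \<beta> []) = \<kappa> * (1 - \<beta> [] * cnj (\<beta> []))"
    by (simp add: \<kappa>_def mult.commute)
  then have "cnj \<kappa> * (1 - \<beta> []) * c [] = \<kappa> * cnj \<kappa> * (1 - \<beta> [] * cnj (\<beta> []))"
    by (metis mult.assoc mult.commute)
  then show ?thesis by (simp add: \<kappa>_mult)
qed

lemma c_Nil_\<kappa>: "c [] - \<kappa> * cnj (\<beta> []) = cnj \<kappa>"
proof -
  have "c [] - \<kappa> * cnj (\<beta> []) = \<kappa> * cnj \<kappa> * (1 - \<beta> [] * cnj (\<beta> []))
      - \<kappa> * cnj (\<beta> []) * (cnj \<kappa> * (1 - \<beta> []))"
    by (simp add: c_Nil \<kappa>_mult)
  also have "\<dots> = \<kappa> * (1 - cnj (\<beta> [])) * cnj \<kappa>" by (simp add: algebra_simps)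
  finally show ?thesis by (simp add: \<kappa>_mult)
qed

lemma c_Nil_cnj: "cnj (c []) = c []"
  by (simp add: c_Nil mult.commute)

definition u where "u = ket [] - Bt"

lemma u_coeff: "ell2_fun u \<gamma> = (if \<gamma> = [] then 1 else 0) - \<beta> \<gamma>"
  by (simp add: u_def minus_ell2.rep_eq Bt_coeff ket.rep_eq)

text \<open>The image of \<open>L\<^sup>\<alpha>\<close> under the weighted Cauchy transform \<open>(I - N) C\<close>. The recursion reflects
  \<open>C (L\<^sub>k p) = L\<^sub>k (C p) + \<mu>(L\<^sub>k p) 1\<close>, and \<open>N\<close> commutes with \<open>L\<^sub>k\<close>, so that the scalar
  \<open>\<mu>(L\<^sub>k p)\<close> becomes the coefficient of \<open>u = (I - N) 1\<close>.\<close>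

primrec v :: "'d list \<Rightarrow> 'd list ell2" where
  "v [] = cscale \<kappa> (ket [] - cscale (cnj (\<beta> [])) Bt)"
| "v (k # \<alpha>) = lshift k (v \<alpha>) + cscale (cnj (c (k # \<alpha>))) u"

lemma v_Nil_coeff: "ell2_fun (v []) \<gamma> = \<kappa> * (unit_series \<gamma> - cnj (\<beta> []) * \<beta> \<gamma>)"
  by (simp add: minus_ell2.rep_eq cscale.rep_eq Bt_coeff ket.rep_eq)

lemma v_Cons_coeff_Nil: "ell2_fun (v (k # \<alpha>)) [] = cnj (c (k # \<alpha>)) * (1 - \<beta> [])"
  by (simp add: plus_ell2.rep_eq cscale.rep_eq u_coeff lshift_coeff)

text \<open>Unfolding \<open>v\<close> once moves the first letter of \<open>\<alpha>\<close> to the end of \<open>w\<close>, hence the induction over all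
  nonempty \<open>w\<close>. Isometry of \<open>N\<close> enters through \<open>\<langle>L\<^sup>w B\<^sup>t, B\<^sup>t\<rangle> = \<langle>e\<^sub>w, 1\<rangle> = 0\<close>: the other
  terms are coefficients of \<open>\<beta>\<close> times conjugate moments or constants, and they add up to a convolution.\<close>

lemma cinner_lshift_word_v_Bt:
  assumes "w \<noteq> []"
  shows "cinner (lshift_word w (v \<alpha>)) Bt
    = conv (\<lambda>x. \<beta> (w @ x)) c \<alpha> - \<kappa> * cnj (\<beta> []) * \<beta> (w @ \<alpha>)"
  using assms
proof (induction \<alpha> arbitrary: w)
  case Nil
  have orth: "cinner (lshift_word w Bt) Bt = 0"
    using Nil by (simp add: Bt_def cinner_N_N lshift_word_ket cinner_ket_left ket.rep_eq flip: N_lshift_word)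
  have "lshift_word w (v []) = cscale \<kappa> (ket w - cscale (cnj (\<beta> [])) (lshift_word w Bt))"
    by (simp add: blinfun.diff_right complex_linear_opD lshift_word_ket)
  then have "cinner (lshift_word w (v [])) Bt = cnj \<kappa> * \<beta> w"
    by (simp add: cinner_cscale_left cinner_diff_left orth cinner_ket_left Bt_coeff)
  also have "\<dots> = c [] * \<beta> w - \<kappa> * cnj (\<beta> []) * \<beta> w"
    by (simp add: c_Nil_\<kappa> flip: left_diff_distrib)
  finally show ?case by (simp add: mult.commute)
next
  case (Cons j \<alpha>)
  have orth: "cinner (lshift_word w Bt) Bt = 0"
    using Cons.prems by (simp add: Bt_def cinner_N_N lshift_word_ket cinner_ket_left ket.rep_eq flip: N_lshift_word)
  have "lshift_word w (v (j # \<alpha>)) = lshift_word (w @ [j]) (v \<alpha>)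
      + cscale (cnj (c (j # \<alpha>))) (ket w - lshift_word w Bt)"
    by (simp add: blinfun.add_right blinfun.diff_right complex_linear_opD lshift_word_ket
        lshift_word_append u_def)
  then have "cinner (lshift_word w (v (j # \<alpha>))) Bt
      = cinner (lshift_word (w @ [j]) (v \<alpha>)) Bt + c (j # \<alpha>) * \<beta> w"
    by (simp add: cinner_add_left cinner_cscale_left cinner_diff_left orth cinner_ket_left Bt_coeff)
  also have "cinner (lshift_word (w @ [j]) (v \<alpha>)) Bt
      = conv (\<lambda>x. \<beta> ((w @ [j]) @ x)) c \<alpha> - \<kappa> * cnj (\<beta> []) * \<beta> ((w @ [j]) @ \<alpha>)"
    by (rule Cons.IH) simp
  finally show ?case by (simp add: conv_Cons mult.commute)
qed

lemma cinner_lshift_v_Bt: "cinner (lshift k (v \<alpha>)) Bt = (1 - \<beta> []) * c (k # \<alpha>)"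
proof -
  have "conv (\<lambda>x. \<beta> (k # x)) c \<alpha> - \<kappa> * cnj (\<beta> []) * \<beta> (k # \<alpha>) = (1 - \<beta> []) * c (k # \<alpha>)"
    using conv_\<beta>_c[of "k # \<alpha>"] by (simp add: conv_Cons \<kappa>_def algebra_simps)
  then show ?thesis using cinner_lshift_word_v_Bt[of "[k]" \<alpha>] by simp
qed

text \<open>Moving \<open>L\<^sub>k\<close> to the left by the product rule leaves two multiples of the constant term of \<open>f\<close>. They
  cancel because of the value of \<open>\<langle>L\<^sub>k (v \<alpha>), B\<^sup>t\<rangle>\<close>, that is because of the relation \<open>conv_\<beta>_c\<close>
  between \<open>\<beta>\<close> and the moments.\<close>

lemma range_N_orthogonal_v: "cinner (N f) (v \<alpha>) = 0"
proof (induction \<alpha> arbitrary: f)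
  case Nil
  show ?case
    by (simp add: cinner_cscale_right cinner_diff_right cinner_ket_right N_coeff Bt_def cinner_N_N)
next
  case (Cons k \<alpha>)
  have B: "cinner (adj (lshift k) Bt) (v \<alpha>) = (1 - cnj (\<beta> [])) * cnj (c (k # \<alpha>))"
    using cinner_lshift_v_Bt[of k \<alpha>] cinner_commute[of Bt "lshift k (v \<alpha>)"]
    by (simp flip: cinner_adj_left)
  have "cinner (N f) (lshift k (v \<alpha>)) = cinner (adj (lshift k) (N f)) (v \<alpha>)"
    by (simp add: cinner_adj_left)
  also have "\<dots> = cnj (ell2_fun f []) * ((1 - cnj (\<beta> [])) * cnj (c (k # \<alpha>)))"
    by (subst adj_lshift_N) (simp add: cinner_add_left cinner_cscale_left Cons.IH B flip: Bt_def)
  finally have 1: "cinner (N f) (lshift k (v \<alpha>)) = \<dots>" .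
  have "cinner (N f) u = cnj (ell2_fun f []) * (cnj (\<beta> []) - 1)"
    by (simp add: u_def cinner_diff_right cinner_ket_right N_coeff Bt_def cinner_N_N algebra_simps)
  then show ?case by (simp add: cinner_add_right cinner_cscale_right 1) (simp add: algebra_simps)
qed

lemma Bt_orthogonal_v: "cinner Bt (v \<alpha>) = 0" "cinner (v \<alpha>) Bt = 0"
  using range_N_orthogonal_v[of "ket []" \<alpha>] cinner_commute[of "v \<alpha>" Bt] by (simp_all add: Bt_def)

lemma cinner_u_v: "cinner u (v \<alpha>) = ell2_fun (v \<alpha>) []"
  by (simp add: u_def cinner_diff_left Bt_orthogonal_v cinner_ket_left)

lemma gram_Nil: "cinner (v []) (v \<alpha>) = cnj \<kappa> * ell2_fun (v \<alpha>) []"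
  by (simp add: cinner_cscale_left cinner_diff_left Bt_orthogonal_v cinner_ket_left)

lemma gram_Nil_Nil: "cinner (v []) (v []) = c []"
  unfolding gram_Nil v_Nil_coeff by (simp add: c_Nil mult_ac)

lemma gram_Nil_Cons: "cinner (v []) (v (k # \<alpha>)) = cnj (c (k # \<alpha>))"
proof -
  have "cinner (v []) (v (k # \<alpha>)) = cnj \<kappa> * (1 - \<beta> []) * cnj (c (k # \<alpha>))"
    unfolding gram_Nil v_Cons_coeff_Nil by simp
  then show ?thesis by (simp add: \<kappa>_mult)
qed

lemma gram_Cons_Nil: "cinner (v (k # \<alpha>)) (v []) = c (k # \<alpha>)"
  using gram_Nil_Cons[of k \<alpha>] cinner_commute[of "v (k # \<alpha>)" "v []"] by simp

text \<open>The inner products of the \<open>v \<alpha>\<close> obey the cancellation rule of \<open>(L\<^sup>\<alpha>)\<^sup>* L\<^sup>\<beta>\<close>: the contributions of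
  \<open>u\<close> cancel.\<close>

lemma gram_Cons_Cons:
  "cinner (v (j # \<alpha>)) (v (k # \<alpha>')) = (if j = k then cinner (v \<alpha>) (v \<alpha>') else 0)"
proof -
  have 1: "cinner (lshift j (v \<alpha>)) u = - ((1 - \<beta> []) * c (j # \<alpha>))"
    unfolding u_def cinner_diff_right cinner_lshift_v_Bt
    by (simp add: cinner_ket_right lshift_coeff)
  have "cinner (v (j # \<alpha>)) (v (k # \<alpha>'))
      = cinner (lshift j (v \<alpha>)) (v (k # \<alpha>')) + c (j # \<alpha>) * cinner u (v (k # \<alpha>'))"
    by (subst v.simps(2)[of j]) (simp only: cinner_add_left cinner_cscale_left complex_cnj_cnj)
  also have "cinner u (v (k # \<alpha>')) = cnj (c (k # \<alpha>')) * (1 - \<beta> [])"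
    unfolding cinner_u_v v_Cons_coeff_Nil ..
  also have "cinner (lshift j (v \<alpha>)) (v (k # \<alpha>')) = (if j = k then cinner (v \<alpha>) (v \<alpha>') else 0)
      - cnj (c (k # \<alpha>')) * (1 - \<beta> []) * c (j # \<alpha>)"
    by (simp add: cinner_add_right cinner_cscale_right 1 cinner_lshift_lshift)
  finally show ?thesis by (simp add: algebra_simps)
qed

text \<open>The vectors that are orthogonal to the range of \<open>N\<close> and equal to \<open>(I - N)\<close> applied, as a formal
  convolution, to the family of their inner products with the \<open>v \<alpha>\<close>. That family is the Cauchy
  transform, which need not be square-summable. Both conditions are closed.\<close>

definition model_space :: "'d list ell2 set" where
  "model_space = {x. (\<forall>f. cinner (N f) x = 0) \<and>
     (\<forall>\<gamma>. ell2_fun x \<gamma> = cinner (v \<gamma>) x - conv (\<lambda>\<alpha>. cinner (v \<alpha>) x) \<beta> \<gamma>)}"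

lemma closed_model_space: "closed model_space"
  unfolding model_space_def conv_def
  by (intro closed_Collect_conj closed_Collect_all closed_Collect_eq continuous_intros)

lemma model_space_add: "x \<in> model_space \<Longrightarrow> y \<in> model_space \<Longrightarrow> x + y \<in> model_space"
  by (simp add: model_space_def cinner_add_right plus_ell2.rep_eq conv_add_left)

lemma model_space_cscale: "x \<in> model_space \<Longrightarrow> cscale a x \<in> model_space"
  by (simp add: model_space_def cinner_cscale_right cscale.rep_eq conv_scale_left right_diff_distrib)

lemma v_model_space: "v \<alpha> \<in> model_space"
proof -
  have "ell2_fun (v \<alpha>) \<gamma> = cinner (v \<gamma>) (v \<alpha>) - conv (\<lambda>\<delta>. cinner (v \<delta>) (v \<alpha>)) \<beta> \<gamma>" for \<gamma>
  proof (induction \<alpha> arbitrary: \<gamma>)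
    case Nil
    have "cinner (v \<delta>) (v []) = c \<delta>" for \<delta>
      by (cases \<delta>) (simp_all only: gram_Nil_Nil gram_Cons_Nil)
    then show ?case unfolding v_Nil_coeff using conv_c_\<beta>[of \<gamma>] by (simp add: \<kappa>_def)
  next
    case (Cons k \<alpha>)
    show ?case
    proof (cases \<gamma>)
      case Nil
      then show ?thesis
        by (simp only: conv_Nil v_Cons_coeff_Nil gram_Nil_Cons) (simp add: algebra_simps)
    next
      case (Cons j \<delta>)
      have 1: "ell2_fun (v (k # \<alpha>)) (j # \<delta>)
          = (if j = k then ell2_fun (v \<alpha>) \<delta> else 0) - cnj (c (k # \<alpha>)) * \<beta> (j # \<delta>)"
        by (simp add: plus_ell2.rep_eq cscale.rep_eq u_coeff lshift_coeff)
      show ?thesis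
        unfolding Cons 1 conv_Cons gram_Nil_Cons gram_Cons_Cons Cons.IH[of \<delta>] by simp
    qed
  qed
  then show ?thesis by (simp add: model_space_def range_N_orthogonal_v)
qed

text \<open>The heart of the argument. Applied to the graph \<open>K\<close> of the weighted Cauchy transform, it says that
  this graph is as far from closable as possible.\<close>

lemma vertical_closure:
  assumes sub: "\<And>p x p' x'. (p, x) \<in> K \<Longrightarrow> (p', x') \<in> K \<Longrightarrow> (p + p', x + x') \<in> K"
    and scale: "\<And>p x a. (p, x) \<in> K \<Longrightarrow> (cscale a p, cscale a x) \<in> K"
    and ket: "\<And>\<alpha>. (ket \<alpha>, v \<alpha>) \<in> K"
    and model: "\<And>p x. (p, x) \<in> K \<Longrightarrow> x \<in> model_space"
    and h: "(h, x0) \<in> K"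
  shows "(0, x0) \<in> closure K"
proof -
  have K0: "(0, 0) \<in> K" using scale[OF h, of 0] by simp
  have "Real_Vector_Spaces.subspace K"
    by (rule real_vector.subspaceI)
      (use K0 sub scale in \<open>auto simp: zero_prod_def scaleR_cscale\<close>)
  then obtain y where y: "y \<in> closure K" "\<And>k. k \<in> K \<Longrightarrow> inner ((0, x0) - y) k = 0"
    using nearest_point_orthogonal by blast
  obtain f g' where fg: "y = (f, g')" by (cases y)
  define g where "g = x0 - g'"
  have re: "Re (cinner x g) = Re (cinner p f)" if "(p, x) \<in> K" for p x
  proof -
    have "inner g x = inner f p" using y(2)[OF that] by (simp add: fg g_def inner_prod_def)
    then have "inner x g = inner p f" by (simp only: inner_commute)
    then show ?thesis by (simp add: inner_ell2_def)
  qed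
  \<comment> \<open>The orthogonality is real a priori; invariance of \<open>K\<close> under multiplication by \<open>\<i>\<close> makes it complex.\<close>
  have orth: "cinner x g = cinner p f" if "(p, x) \<in> K" for p x
    using re[OF that] re[OF scale[OF that, of \<i>]] by (simp add: cinner_cscale_left complex_eq_iff)
  have f_coeff: "ell2_fun f \<alpha> = cinner (v \<alpha>) g" for \<alpha>
    using orth[OF ket[of \<alpha>]] by (simp add: cinner_ket_left)
  have "g' \<in> model_space"
  proof -
    obtain X where X: "\<And>n. X n \<in> K" "X \<longlonglongrightarrow> (f, g')"
      using y(1) unfolding fg closure_sequential by blast
    have "snd (X n) \<in> model_space" for n
      using X(1)[of n] model by (metis prod.collapse)
    moreover have "(\<lambda>n. snd (X n)) \<longlonglongrightarrow> g'" using tendsto_snd[OF X(2)] by simp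
    ultimately show ?thesis by (rule closed_sequentially[OF closed_model_space])
  qed
  then have gm: "g \<in> model_space"
    using model_space_add[OF model[OF h] model_space_cscale[of g' "-1"]]
    by (simp add: g_def cscale_minus1)
  \<comment> \<open>The Cauchy transform of \<open>g\<close> is the square-summable \<open>f\<close>, so the formal convolution is \<open>N\<close>.\<close>
  have g: "g = f - N f"
  proof -
    have "ell2_fun g \<gamma> = ell2_fun f \<gamma> - conv (ell2_fun f) \<beta> \<gamma>" for \<gamma>
      using gm unfolding model_space_def by (simp add: f_coeff[abs_def])
    then show ?thesis
      by (simp add: fun_eq_iff minus_ell2.rep_eq N_coeff flip: ell2_fun_inject)
  qed
  have "cinner (N f) g = 0" using gm by (simp add: model_space_def)
  then have "inner (N f) f = (norm f)\<^sup>2"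
    by (simp add: g cinner_diff_right inner_ell2_def cinner_self_norm N_norm)
  moreover have "(norm (f - N f))\<^sup>2 = (norm f)\<^sup>2 + (norm (N f))\<^sup>2 - 2 * inner (N f) f"
    unfolding power2_norm_eq_inner inner_diff_left inner_diff_right
    using inner_commute[of f "N f"] by linarith
  ultimately have "(norm (f - N f))\<^sup>2 = 0" by (simp add: N_norm)
  then have g0: "g = 0" by (simp add: g)
  have "ell2_fun f \<alpha> = 0" for \<alpha> by (simp only: f_coeff g0 cinner_zero)
  then have "f = 0" by (simp add: fun_eq_iff zero_ell2.rep_eq flip: ell2_fun_inject)
  then show ?thesis using y(1) g0 by (simp add: fg g_def)
qed

end

section \<open>Positive semi-definite forms\<close>

lemma psd_form_add: "psd_form (D, q) \<Longrightarrow> f \<in> D \<Longrightarrow> g \<in> D \<Longrightarrow> f + g \<in> D"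
  by (simp add: psd_form_def)

lemma psd_form_diff:
  assumes "psd_form (D, q)" "f \<in> D" "g \<in> D" shows "f - g \<in> D"
proof -
  have "cscale (-1) g \<in> D" using assms by (simp add: psd_form_def)
  then show ?thesis using psd_form_add[OF assms(1,2), of "cscale (-1) g"] by (simp add: cscale_minus1)
qed

lemma psd_form_nonneg: "psd_form (D, q) \<Longrightarrow> f \<in> D \<Longrightarrow> 0 \<le> Re (q f f)"
  by (simp add: psd_form_def complex_nonneg_Reals_iff)

lemma psd_form_cmod: "psd_form (D, q) \<Longrightarrow> f \<in> D \<Longrightarrow> cmod (q f f) = Re (q f f)"
  by (simp add: psd_form_def complex_nonneg_Reals_iff cmod_eq_Re)

text \<open>From the parallelogram identity, by dropping \<open>q(f - g, f - g) \<ge> 0\<close>.\<close>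

lemma psd_form_add_le:
  assumes Q: "psd_form (D, q)" and f: "f \<in> D" and g: "g \<in> D"
  shows "Re (q (f + g) (f + g)) \<le> 2 * Re (q f f) + 2 * Re (q g g)"
proof -
  let ?g = "cscale (-1) g"
  have g': "?g \<in> D" using Q g by (simp add: psd_form_def)
  have "q (f + g) (f + g) = q f f + q f g + (q g f + q g g)"
    using Q f g by (simp add: psd_form_def)
  moreover have "q (f + ?g) (f + ?g) = q f f - q f g - (q g f - q g g)"
    using Q f g g' unfolding psd_form_def by simp
  moreover have "0 \<le> Re (q (f + ?g) (f + ?g))"
    using Q psd_form_add[OF Q f g'] by (rule psd_form_nonneg)
  ultimately show ?thesis by simp
qed

text \<open>The closed extension has \<open>0\<close> as the limit of the sequence, and it agrees with \<open>q\<close> on \<open>D\<close>.\<close>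

lemma closable_form_null_sequence:
  assumes cl: "closable_form (D, q)" and X: "\<And>n. X n \<in> D" "X \<longlonglongrightarrow> 0"
    and cauchy: "\<And>e. e > 0 \<Longrightarrow> \<exists>M. \<forall>m\<ge>M. \<forall>n\<ge>M. Re (q (X m - X n) (X m - X n)) < e"
  shows "(\<lambda>n. Re (q (X n) (X n))) \<longlonglongrightarrow> 0"
proof -
  have psd: "psd_form (D, q)" using cl by (simp add: closable_form_def)
  obtain D' q' where Q': "closed_form (D', q')" "form_extends (D', q') (D, q)"
    using cl unfolding closable_form_def by auto
  have sub: "D \<subseteq> D'" and eq: "\<And>f g. f \<in> D \<Longrightarrow> g \<in> D \<Longrightarrow> q' f g = q f g"
    using Q'(2) by (auto simp: form_extends_def)
  have diff: "X m - X n \<in> D" for m n by (rule psd_form_diff[OF psd X(1) X(1)])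
  have "\<forall>e>0. \<exists>N. \<forall>m\<ge>N. \<forall>n\<ge>N. cmod (q' (X m - X n) (X m - X n)) < e"
    using cauchy by (simp add: eq diff psd_form_cmod[OF psd])
  then have "(\<lambda>n. q' (X n - 0) (X n - 0)) \<longlonglongrightarrow> 0"
    using Q'(1) X sub unfolding closed_form_def by blast
  then have "(\<lambda>n. q (X n) (X n)) \<longlonglongrightarrow> 0" by (simp add: eq X)
  then show ?thesis using tendsto_Re by fastforce
qed

lemma complex_subspace_of_kets_dense:
  assumes "\<And>f g. f \<in> D \<Longrightarrow> g \<in> D \<Longrightarrow> f + g \<in> D" "\<And>c f. f \<in> D \<Longrightarrow> cscale c f \<in> D"
    and "\<And>a. ket a \<in> D"
  shows "closure D = UNIV"
proof -
  have "f \<in> closure D" for f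
  proof (rule ell2_induct_closed)
    show "cscale c f \<in> closure D" if "f \<in> closure D" for c f
      by (rule image_closure_subset_closed[OF _ _ _ that])
        (use assms(2) in \<open>auto intro!: continuous_intros intro: closure_subset[THEN subsetD]\<close>)
  qed (use assms in \<open>auto intro: closure_add_mem closure_subset[THEN subsetD]\<close>)
  then show ?thesis by auto
qed

lemma zero_form_closable:
  assumes "0 \<in> D" "\<And>f g. f \<in> D \<Longrightarrow> g \<in> D \<Longrightarrow> f + g \<in> D" "\<And>c f. f \<in> D \<Longrightarrow> cscale c f \<in> D"
    and "closure D = UNIV"
  shows "closable_form (D, \<lambda>_ _. 0)"
proof -
  have "closed_form (UNIV :: 'a ell2 set, \<lambda>_ _. 0)"
    by (simp add: closed_form_def psd_form_def)
  moreover have "form_extends (UNIV, \<lambda>_ _. 0) (D, \<lambda>_ _. 0)"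
    by (simp add: form_extends_def)
  ultimately show ?thesis
    using assms by (auto simp: closable_form_def psd_form_def)
qed

section \<open>Closable forms below the Clark measure\<close>

locale clark_vectors = inner_kernel N \<beta> c for N and \<beta> c :: "'d list \<Rightarrow> complex" +
  fixes \<mu> :: "'d list operator \<Rightarrow> complex"
  assumes \<mu>: "positive_nc_measure \<mu>"
    and \<mu>_word: "\<mu> (lshift_word \<alpha>) = cnj (c \<alpha>)"
begin

lemma \<mu>_gram_word: "\<mu> (adj (lshift_word \<alpha>) o\<^sub>L lshift_word \<gamma>) = cinner (v \<alpha>) (v \<gamma>)"
proof (induction \<alpha> arbitrary: \<gamma>)
  case Nil
  show ?case
    by (cases \<gamma>) (simp_all only: lshift_word_Nil adj_id compose_id gram_Nil_Nil gram_Nil_Cons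
        \<mu>_word[of "[]", unfolded lshift_word_Nil] c_Nil_cnj \<mu>_word)
next
  case (Cons j \<alpha>)
  show ?case
  proof (cases \<gamma>)
    case Nil
    have "\<mu> (adj (lshift_word (j # \<alpha>))) = cnj (\<mu> (lshift_word (j # \<alpha>)))"
      by (intro nc_measure_adj[OF \<mu>] free_polys_disk_algebra lshift_word_free_polys)
    then show ?thesis
      by (simp only: Nil lshift_word_Nil compose_id gram_Cons_Nil \<mu>_word complex_cnj_cnj)
  next
    case (Cons k \<delta>)
    then show ?thesis
      by (simp only: adj_lshift_word_lshift_word gram_Cons_Cons Cons.IH nc_measure_0[OF \<mu>]
          split: if_split) simp
  qed
qed

text \<open>The graph of the isometry \<open>L\<^sup>\<alpha> \<mapsto> v \<alpha>\<close> on polynomials, as a relation; since it is generated linearly,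
  properties of the isometry follow from those on words by induction.\<close>

inductive represents :: "'d list operator \<Rightarrow> 'd list ell2 \<Rightarrow> bool" where
  word: "represents (lshift_word \<alpha>) (v \<alpha>)"
| add: "represents S x \<Longrightarrow> represents T y \<Longrightarrow> represents (S + T) (x + y)"
| scale: "represents T x \<Longrightarrow> represents (scale_op a o\<^sub>L T) (cscale a x)"

lemma represents_free_polys: "represents T x \<Longrightarrow> T \<in> free_polys"
  by (induction rule: represents.induct) (auto intro: free_polys.intros lshift_word_free_polys)

lemma represents_disk_algebra: "represents T x \<Longrightarrow> T \<in> disk_algebra"
  by (intro free_polys_disk_algebra represents_free_polys)

lemma represents_ex:
  assumes "T \<in> free_polys" obtains x where "represents T x"
proof -
  have "\<exists>x. represents T x" using free_polys_word_span[OF assms]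
    by induction (auto intro: represents.intros)
  then show thesis using that by blast
qed

lemma represents_diff: "represents S x \<Longrightarrow> represents T y \<Longrightarrow> represents (S - T) (x - y)"
  using represents.add[of S x "scale_op (-1) o\<^sub>L T" "cscale (-1) y"] represents.scale[of T y "-1"]
  by (simp add: scale_op_minus1 cscale_minus1)

lemma represents_model_space: "represents T x \<Longrightarrow> x \<in> model_space"
  by (induction rule: represents.induct)
    (auto intro: v_model_space model_space_add model_space_cscale)

lemma \<mu>_gram:
  assumes S: "represents S x" and T: "represents T y"
  shows "\<mu> (adj S o\<^sub>L T) = cinner x y"
proof -
  have left_word: "\<mu> (adj (lshift_word \<alpha>) o\<^sub>L T) = cinner (v \<alpha>) y" if "represents T y" for \<alpha> T y
    using that
  proof induction
    case (word \<gamma>)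
    show ?case by (rule \<mu>_gram_word)
  next
    case (add S x T y)
    then show ?case
      by (simp add: compose_add_distrib cinner_add_right nc_measure_add[OF \<mu>]
          adj_compose_disk_system represents_disk_algebra free_polys_disk_algebra lshift_word_free_polys)
  next
    case (scale T x a)
    then show ?case
      by (simp add: compose_scale_op complex_linear_op_adj cinner_cscale_right nc_measure_scale[OF \<mu>]
          adj_compose_disk_system represents_disk_algebra free_polys_disk_algebra lshift_word_free_polys)
  qed
  note dT = represents_disk_algebra[OF T]
  show ?thesis using S
  proof induction
    case (word \<alpha>)
    show ?case by (rule left_word[OF T])
  next
    case (add S x S' x')
    then show ?case
      by (simp add: adj_add represents_disk_algebra disk_algebra_complex_linear compose_add_distrib
          cinner_add_left nc_measure_add[OF \<mu>] adj_compose_disk_system dT)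
  next
    case (scale S x a)
    then show ?case
      by (simp add: adj_scale represents_disk_algebra disk_algebra_complex_linear compose_assoc
          cinner_cscale_left nc_measure_scale[OF \<mu>] adj_compose_disk_system dT)
  qed
qed

lemma nc_form_apply:
  assumes "T \<in> disk_algebra"
  shows "T (ket []) \<in> fst (nc_form \<mu>)" "snd (nc_form \<mu>) (T (ket [])) (T (ket [])) = \<mu> (adj T o\<^sub>L T)"
  using assms by (auto simp: nc_form_def disk_symbol_eq)

text \<open>Polynomials that are small in the Fock space and close to \<open>S\<close> for the form of \<open>\<mu>\<close>.\<close>

lemma represents_null_sequence:
  assumes "represents S x"
  obtains T X where "\<And>n::nat. represents (T n) (X n)" "(\<lambda>n. T n (ket [])) \<longlonglongrightarrow> 0" "X \<longlonglongrightarrow> x"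
proof -
  let ?K = "{(blinfun_apply T (ket []), x) | T x. represents T x}"
  have "(0, x) \<in> closure ?K"
  proof (rule vertical_closure)
    show "(p + p', x + x') \<in> ?K" if K: "(p, x) \<in> ?K" "(p', x') \<in> ?K" for p p' x x'
    proof -
      obtain T T' where "represents T x" "p = T (ket [])" "represents T' x'" "p' = T' (ket [])"
        using K by blast
      then show ?thesis by (auto simp: blinfun.add_left intro!: exI[of _ "T + T'"] represents.add)
    qed
    show "(cscale a p, cscale a x) \<in> ?K" if K: "(p, x) \<in> ?K" for p x a
    proof -
      obtain T where "represents T x" "p = T (ket [])" using K by blast
      then show ?thesis
        by (auto simp: scale_op.rep_eq intro!: exI[of _ "scale_op a o\<^sub>L T"] represents.scale)
    qed
    show "(ket \<alpha>, v \<alpha>) \<in> ?K" for \<alpha>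
      using represents.word[of \<alpha>] lshift_word_ket[of \<alpha> "[]"] by force
    show "x \<in> model_space" if "(p, x) \<in> ?K" for p x
      using that represents_model_space by blast
    show "(S (ket []), x) \<in> ?K" using assms by blast
  qed
  then obtain Z where Z: "\<And>n. Z n \<in> ?K" "Z \<longlonglongrightarrow> (0, x)"
    unfolding closure_sequential by blast
  have "\<forall>n. \<exists>T y. Z n = (blinfun_apply T (ket []), y) \<and> represents T y" using Z(1) by fastforce
  then obtain T :: "nat \<Rightarrow> 'd list operator" and X where *: "\<And>n. Z n = (T n (ket []), X n)" "\<And>n. represents (T n) (X n)"
    by metis
  show thesis
    by (rule that[of T X]) (use * tendsto_fst[OF Z(2)] tendsto_snd[OF Z(2)] in simp_all)
qed

text \<open>For polynomials, \<open>q\<close> is controlled along a null sequence from two sides: by closability and by the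
  form of \<open>\<mu>\<close>. The disk algebra follows because the form of \<open>\<mu>\<close> is bounded by the operator norm.\<close>

lemma closable_form_vanishes:
  assumes cl: "closable_form (D, q)" and le: "form_le (D, q) (nc_form \<mu>)" and S: "S \<in> disk_algebra"
  shows "Re (q (S (ket [])) (S (ket []))) \<le> 0"
proof -
  have psd: "psd_form (D, q)" using cl by (simp add: closable_form_def)
  have D: "T (ket []) \<in> D" if "T \<in> disk_algebra" for T
    using le nc_form_apply(1)[OF that] by (auto simp: form_le_def)
  have q_le: "Re (q (T (ket [])) (T (ket []))) \<le> Re (\<mu> (adj T o\<^sub>L T))" if "T \<in> disk_algebra" for T
    using le nc_form_apply[OF that] by (auto simp: form_le_def)
  have q_rep: "Re (q (T (ket [])) (T (ket []))) \<le> (norm y)\<^sup>2" if "represents T y" for T y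
    using q_le[OF represents_disk_algebra[OF that]] \<mu>_gram[OF that that] by (simp add: cinner_self_norm)
  have split: "Re (q (T (ket [])) (T (ket []))) \<le>
      2 * Re (q ((T - T') (ket [])) ((T - T') (ket []))) + 2 * Re (q (T' (ket [])) (T' (ket [])))"
    if "T \<in> disk_algebra" "T' \<in> disk_algebra" for T T'
    using psd_form_add_le[OF psd D[OF disk_algebra_diff[OF that]] D[OF that(2)]]
    by (simp add: blinfun.diff_left)
  have poly: "Re (q (T (ket [])) (T (ket []))) \<le> 0" if T: "represents T x" for T x
  proof -
    obtain P X where P: "\<And>n::nat. represents (P n) (X n)" "(\<lambda>n. P n (ket [])) \<longlonglongrightarrow> 0" "X \<longlonglongrightarrow> x"
      using represents_null_sequence[OF T] by blast
    have "(\<lambda>n. Re (q (P n (ket [])) (P n (ket [])))) \<longlonglongrightarrow> 0"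
    proof (rule closable_form_null_sequence[OF cl])
      fix e :: real assume e: "e > 0"
      obtain M where M: "\<And>m n. m \<ge> M \<Longrightarrow> n \<ge> M \<Longrightarrow> norm (X m - X n) < sqrt e"
        using metric_CauchyD[OF LIMSEQ_imp_Cauchy[OF P(3)], of "sqrt e"] e
        unfolding dist_norm by auto
      have "Re (q (P m (ket []) - P n (ket [])) (P m (ket []) - P n (ket []))) < e"
        if "m \<ge> M" "n \<ge> M" for m n
      proof -
        have "Re (q (P m (ket []) - P n (ket [])) (P m (ket []) - P n (ket []))) \<le> (norm (X m - X n))\<^sup>2"
          using q_rep[OF represents_diff[OF P(1)[of m] P(1)[of n]]] by (simp add: blinfun.diff_left)
        also have "\<dots> < (sqrt e)\<^sup>2" using M[OF that] by (intro power_strict_mono) auto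
        finally show ?thesis using e by simp
      qed
      then show "\<exists>M. \<forall>m\<ge>M. \<forall>n\<ge>M. Re (q (P m (ket []) - P n (ket [])) (P m (ket []) - P n (ket []))) < e"
        by blast
    qed (use P D represents_disk_algebra in auto)
    then have "(\<lambda>n. 2 * (norm (x - X n))\<^sup>2 + 2 * Re (q (P n (ket [])) (P n (ket []))))
        \<longlonglongrightarrow> 2 * (norm (x - x))\<^sup>2 + 2 * 0"
      by (intro tendsto_intros P)
    moreover have "Re (q (T (ket [])) (T (ket []))) \<le>
        2 * (norm (x - X n))\<^sup>2 + 2 * Re (q (P n (ket [])) (P n (ket [])))" for n
      using split[OF represents_disk_algebra[OF T] represents_disk_algebra[OF P(1)], of n]
        q_rep[OF represents_diff[OF T P(1)], of n] by linarith
    ultimately have "Re (q (T (ket [])) (T (ket []))) \<le> 2 * (norm (x - x))\<^sup>2 + 2 * 0"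
      by (intro LIMSEQ_le_const) blast+
    then show ?thesis by simp
  qed
  obtain P where P: "\<And>n. P n \<in> free_polys" "P \<longlonglongrightarrow> S"
    using S unfolding disk_algebra_def closure_sequential by blast
  have "(\<lambda>n. 2 * ((norm (S - P n))\<^sup>2 * Re (\<mu> id_blinfun))) \<longlonglongrightarrow> 2 * ((norm (S - S))\<^sup>2 * Re (\<mu> id_blinfun))"
    by (intro tendsto_intros P)
  moreover have "Re (q (S (ket [])) (S (ket []))) \<le> 2 * ((norm (S - P n))\<^sup>2 * Re (\<mu> id_blinfun))" for n
  proof -
    note Pn = free_polys_disk_algebra[OF P(1)[of n]]
    obtain x where "represents (P n) x" using represents_ex[OF P(1)] by blast
    from poly[OF this] split[OF S Pn] q_le[OF disk_algebra_diff[OF S Pn]]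
      nc_measure_gram_le[OF \<mu> disk_algebra_diff[OF S Pn]] show ?thesis by linarith
  qed
  ultimately have "Re (q (S (ket [])) (S (ket []))) \<le> 2 * ((norm (S - S))\<^sup>2 * Re (\<mu> id_blinfun))"
    by (intro LIMSEQ_le_const) blast+
  then show ?thesis by simp
qed

lemma singular: "singular_nc_measure \<mu>"
proof -
  define D where "D = fst (nc_form \<mu>)"
  have D: "D = (\<lambda>a. blinfun_apply a (ket [])) ` disk_algebra" by (simp add: D_def nc_form_def)
  have add: "f + g \<in> D" if "f \<in> D" "g \<in> D" for f g
    using that disk_algebra_add unfolding D by (force simp flip: blinfun.add_left)
  have scale: "cscale a f \<in> D" if f: "f \<in> D" for a f
  proof -
    obtain T where "T \<in> disk_algebra" "f = T (ket [])" using f unfolding D by blast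
    then show ?thesis
      unfolding D by (intro image_eqI[of _ _ "scale_op a o\<^sub>L T"]) (simp_all add: scale_op.rep_eq disk_algebra_scale)
  qed
  have ket: "ket \<alpha> \<in> D" for \<alpha>
    unfolding D using lshift_word_ket[of \<alpha> "[]"]
    by (intro image_eqI[of _ _ "lshift_word \<alpha>"]) (simp_all add: free_polys_disk_algebra lshift_word_free_polys)
  have zero: "0 \<in> D" using scale[OF ket, of 0] by simp
  have "closable_form (D, \<lambda>_ _. 0)"
    by (intro zero_form_closable zero add scale complex_subspace_of_kets_dense ket)
  moreover have "form_le (D, \<lambda>_ _. 0) (nc_form \<mu>)"
    using nc_measure_gram_nonneg[OF \<mu>] nc_form_apply(2)
    by (auto simp: form_le_def D_def[symmetric]) (auto simp: D complex_nonneg_Reals_iff)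
  moreover have "form_le Q (D, \<lambda>_ _. 0)" if Q: "closable_form Q" "form_le Q (nc_form \<mu>)" for Q
  proof -
    obtain D' q where "Q = (D', q)" by (cases Q)
    then show ?thesis
      using closable_form_vanishes[of D' q] Q unfolding form_le_def D_def[symmetric] by (auto simp: D)
  qed
  ultimately have "is_max_closable (nc_form \<mu>) (D, \<lambda>_ _. 0)" by (simp add: is_max_closable_def)
  then show ?thesis unfolding singular_nc_measure_def by (intro exI[of _ "(D, \<lambda>_ _. 0)"]) simp
qed

end

section \<open>Coefficients of the Herglotz transform\<close>

text \<open>For the word \<open>\<delta> = k\<^sub>0 \<cdots> k\<^sub>n\<^sub>-\<^sub>1\<close>, half the matrix unit \<open>E\<^sub>i\<^sub>,\<^sub>i\<^sub>+\<^sub>1\<close> is put into the component with index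
  \<open>k\<^sub>i\<close>. A word in this tuple has a nonzero \<open>(i, j)\<close> entry only if it is the subword of \<open>\<delta>\<close> between
  the positions \<open>i\<close> and \<open>j\<close>; the factor \<open>1/2\<close> places the tuple inside the row ball.\<close>

definition path_tuple :: "'d list \<Rightarrow> 'd \<Rightarrow> complex mat" where
  "path_tuple \<delta> k = mat (Suc (length \<delta>)) (Suc (length \<delta>))
     (\<lambda>(i, j). if j = Suc i \<and> \<delta> ! i = k then 1 / 2 else 0)"

lemma path_tuple_carrier: "path_tuple \<delta> k \<in> carrier_mat (Suc (length \<delta>)) (Suc (length \<delta>))"
  by (simp add: path_tuple_def)

lemma mat_word_carrier:
  "(\<And>k. Z k \<in> carrier_mat n n) \<Longrightarrow> mat_word n Z \<alpha> \<in> carrier_mat n n"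
  by (induction \<alpha>) (auto simp: mat_word_def intro: mult_carrier_mat)

lemma mat_word_path_tuple:
  assumes "i \<le> length \<delta>" "j \<le> length \<delta>"
  shows "mat_word (Suc (length \<delta>)) (path_tuple \<delta>) \<alpha> $$ (i, j)
    = (if j = i + length \<alpha> \<and> take (length \<alpha>) (drop i \<delta>) = \<alpha> then (1 / 2) ^ length \<alpha> else 0)"
  using assms
proof (induction \<alpha> arbitrary: i)
  case Nil
  then show ?case by (simp add: mat_word_def)
next
  case (Cons k \<alpha>)
  let ?n = "Suc (length \<delta>)"
  let ?M = "mat_word ?n (path_tuple \<delta>) \<alpha>"
  have M: "?M \<in> carrier_mat ?n ?n" by (rule mat_word_carrier[OF path_tuple_carrier])
  have "mat_word ?n (path_tuple \<delta>) (k # \<alpha>) $$ (i, j) = (path_tuple \<delta> k * ?M) $$ (i, j)"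
    by (simp add: mat_word_def)
  also have "\<dots> = (\<Sum>l\<in>{0..<?n}. path_tuple \<delta> k $$ (i, l) * ?M $$ (l, j))"
    using Cons.prems M path_tuple_carrier[of \<delta> k] by (simp add: scalar_prod_def del: sum.op_ivl_Suc)
  also have "\<dots> = (\<Sum>l\<in>{0..<?n}. if l = Suc i then (if \<delta> ! i = k then 1 / 2 * ?M $$ (l, j) else 0) else 0)"
    by (rule sum.cong) (use Cons.prems in \<open>auto simp: path_tuple_def\<close>)
  also have "\<dots> = (if i < length \<delta> \<and> \<delta> ! i = k then 1 / 2 * ?M $$ (Suc i, j) else 0)"
    by (simp del: sum.op_ivl_Suc)
  also have "\<dots> = (if j = i + length (k # \<alpha>) \<and> take (length (k # \<alpha>)) (drop i \<delta>) = k # \<alpha>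
      then (1 / 2) ^ length (k # \<alpha>) else 0)"
  proof (cases "i < length \<delta>")
    case True
    then have "drop i \<delta> = \<delta> ! i # drop (Suc i) \<delta>" by (simp add: Cons_nth_drop_Suc)
    then show ?thesis using True Cons.IH[of "Suc i"] Cons.prems by (auto split: if_splits)
  qed simp
  finally show ?case .
qed

lemma row_gram_path_tuple:
  fixes \<delta> :: "'d::finite list"
  assumes "i \<le> length \<delta>" "j \<le> length \<delta>"
  shows "row_gram (Suc (length \<delta>)) (path_tuple \<delta>) $$ (i, j) = (if i = j \<and> i < length \<delta> then 1 / 4 else 0)"
proof -
  let ?n = "Suc (length \<delta>)"
  have "(path_tuple \<delta> k * mat_adjoint (path_tuple \<delta> k)) $$ (i, j)
      = (if i = j \<and> i < length \<delta> \<and> \<delta> ! i = k then 1 / 4 else 0)" for k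
  proof -
    have "(path_tuple \<delta> k * mat_adjoint (path_tuple \<delta> k)) $$ (i, j)
        = (\<Sum>l\<in>{0..<?n}. path_tuple \<delta> k $$ (i, l) * cnj (path_tuple \<delta> k $$ (j, l)))"
      using assms path_tuple_carrier[of \<delta> k]
      by (simp add: scalar_prod_def mat_adjoint_def mat_of_rows_def del: sum.op_ivl_Suc)
    also have "\<dots> = (\<Sum>l\<in>{0..<?n}. if l = Suc i then (if i = j \<and> \<delta> ! i = k then 1 / 4 else 0) else 0)"
      by (rule sum.cong) (use assms in \<open>auto simp: path_tuple_def\<close>)
    also have "\<dots> = (if i = j \<and> i < length \<delta> \<and> \<delta> ! i = k then 1 / 4 else 0)"
      by (auto simp del: sum.op_ivl_Suc)
    finally show ?thesis .
  qed
  then have "row_gram ?n (path_tuple \<delta>) $$ (i, j)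
      = (\<Sum>k\<in>UNIV. if k = \<delta> ! i then (if i = j \<and> i < length \<delta> then 1 / 4 else 0) else 0)"
    using assms by (auto simp: row_gram_def intro!: sum.cong)
  then show ?thesis by simp
qed

lemma path_tuple_row_ball:
  fixes \<delta> :: "'d::finite list"
  shows "path_tuple \<delta> \<in> row_ball (Suc (length \<delta>))"
  unfolding row_ball_def
proof (safe intro!: path_tuple_carrier)
  let ?n = "Suc (length \<delta>)"
  fix x :: "complex vec" assume x: "x \<in> carrier_vec ?n" "x \<noteq> 0\<^sub>v ?n"
  let ?A = "1\<^sub>m ?n - row_gram ?n (path_tuple \<delta>)"
  have A: "?A \<in> carrier_mat ?n ?n" by (intro minus_carrier_mat) (simp add: row_gram_def)
  have Ax: "(?A *\<^sub>v x) $ i = (if i < length \<delta> then 3 / 4 else 1) * x $ i" if i: "i < ?n" for i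
  proof -
    have "(A *\<^sub>v x) $ i = (\<Sum>l\<in>{0..<?n}. A $$ (i, l) * x $ l)"
      if "A \<in> carrier_mat ?n ?n" for A
      using i x that by (simp add: scalar_prod_def del: sum.op_ivl_Suc)
    from this[OF A] have "(?A *\<^sub>v x) $ i = (\<Sum>l\<in>{0..<?n}. ?A $$ (i, l) * x $ l)" .
    also have "\<dots> = (\<Sum>l\<in>{0..<?n}. if l = i then (if i < length \<delta> then 3 / 4 else 1) * x $ i else 0)"
    proof (rule sum.cong)
      fix l assume "l \<in> {0..<?n}"
      then have "?A $$ (i, l) = (if i = l then 1 else 0) - (if i = l \<and> i < length \<delta> then 1 / 4 else 0)"
        using i row_gram_path_tuple[of i \<delta> l] by (simp add: row_gram_def)
      then show "?A $$ (i, l) * x $ l = (if l = i then (if i < length \<delta> then 3 / 4 else 1) * x $ i else 0)"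
        by auto
    qed simp
    also have "\<dots> = (if i < length \<delta> then 3 / 4 else 1) * x $ i"
      using i by (simp del: sum.op_ivl_Suc)
    finally show ?thesis .
  qed
  have "(?A *\<^sub>v x) \<bullet>c x = (\<Sum>i\<in>{0..<?n}. (?A *\<^sub>v x) $ i * cnj (x $ i))"
    using x by (simp add: scalar_prod_def del: sum.op_ivl_Suc)
  also have "\<dots> = (\<Sum>i\<in>{0..<?n}. of_real ((if i < length \<delta> then 3 / 4 else 1) * (cmod (x $ i))\<^sup>2))"
    by (rule sum.cong) (auto simp: Ax simp flip: complex_norm_square simp del: sum.op_ivl_Suc)
  finally have eq: "Re ((?A *\<^sub>v x) \<bullet>c x) = (\<Sum>i\<in>{0..<?n}. (if i < length \<delta> then 3 / 4 else 1) * (cmod (x $ i))\<^sup>2)"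
    by (simp only: Re_sum Re_complex_of_real)
  obtain i where i: "i < ?n" "x $ i \<noteq> 0"
    using x by (metis carrier_vecD eq_vecI index_zero_vec(1) index_zero_vec(2))
  show "0 < Re ((?A *\<^sub>v x) \<bullet>c x)"
    unfolding eq by (rule sum_pos2[of _ i]) (use i in auto)
qed

text \<open>Only one word contributes to each entry, so the sum of the power series there is a single term.\<close>

lemma nc_expansion_path_tuple:
  fixes F :: "('d::finite \<Rightarrow> complex mat) \<Rightarrow> complex mat"
  assumes F: "nc_expansion F c" and ij: "i \<le> length \<delta>" "j \<le> length \<delta>"
  shows "F (path_tuple \<delta>) $$ (i, j)
    = (if i \<le> j then (1 / 2) ^ (j - i) * c (take (j - i) (drop i \<delta>)) else 0)"
proof -
  let ?t = "\<lambda>\<alpha>. c \<alpha> * mat_word (Suc (length \<delta>)) (path_tuple \<delta>) \<alpha> $$ (i, j)"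
  let ?\<alpha> = "take (j - i) (drop i \<delta>)"
  let ?S = "if i \<le> j then (1 / 2) ^ (j - i) * c ?\<alpha> else 0"
  have "(?t has_sum F (path_tuple \<delta>) $$ (i, j)) UNIV"
    using F path_tuple_row_ball[of \<delta>] ij unfolding nc_expansion_def
    by (metis le_imp_less_Suc le_add1 plus_1_eq_Suc)
  moreover have "(?t has_sum ?S) {?\<alpha>}"
    by (rule has_sum_finiteI) (use ij in \<open>auto simp: mat_word_path_tuple\<close>)
  then have "(?t has_sum ?S) UNIV"
    by (rule has_sum_cong_neutral[THEN iffD1, rotated -1])
      (use ij in \<open>auto simp: mat_word_path_tuple\<close>)
  ultimately show ?thesis by (rule has_sum_unique)
qed

text \<open>The shape of the value at \<open>path_tuple \<delta>\<close> of a power series with coefficients \<open>c\<close>.\<close>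

definition coeffs_on_path :: "'d list \<Rightarrow> complex mat \<Rightarrow> ('d list \<Rightarrow> complex) \<Rightarrow> bool" where
  "coeffs_on_path \<delta> A c \<longleftrightarrow> A \<in> carrier_mat (Suc (length \<delta>)) (Suc (length \<delta>)) \<and>
     (\<forall>i\<le>length \<delta>. \<forall>j\<le>length \<delta>. A $$ (i, j)
       = (if i \<le> j then (1 / 2) ^ (j - i) * c (take (j - i) (drop i \<delta>)) else 0))"

lemma nc_expansion_coeffs_on_path:
  fixes F :: "('d::finite \<Rightarrow> complex mat) \<Rightarrow> complex mat"
  assumes "nc_expansion F c" shows "coeffs_on_path \<delta> (F (path_tuple \<delta>)) c"
  using assms nc_expansion_path_tuple[OF assms] path_tuple_row_ball[of \<delta>]
  unfolding coeffs_on_path_def nc_expansion_def by (metis le_add1 plus_1_eq_Suc)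

lemma coeffs_on_path_one: "coeffs_on_path \<delta> (1\<^sub>m (Suc (length \<delta>))) unit_series"
  by (auto simp: coeffs_on_path_def)

lemma coeffs_on_path_add:
  "coeffs_on_path \<delta> A a \<Longrightarrow> coeffs_on_path \<delta> C c \<Longrightarrow> coeffs_on_path \<delta> (A + C) (\<lambda>\<gamma>. a \<gamma> + c \<gamma>)"
  by (auto simp: coeffs_on_path_def distrib_left)

lemma coeffs_on_path_diff:
  "coeffs_on_path \<delta> A a \<Longrightarrow> coeffs_on_path \<delta> C c \<Longrightarrow> coeffs_on_path \<delta> (A - C) (\<lambda>\<gamma>. a \<gamma> - c \<gamma>)"
  by (auto simp: coeffs_on_path_def right_diff_distrib)

lemma coeffs_on_path_corner:
  "coeffs_on_path \<delta> A a \<Longrightarrow> A $$ (0, length \<delta>) = (1 / 2) ^ length \<delta> * a \<delta>"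
  by (simp add: coeffs_on_path_def)

lemma coeffs_on_path_mult_corner:
  assumes A: "coeffs_on_path \<delta> A a" and C: "coeffs_on_path \<delta> C c"
  shows "(A * C) $$ (0, length \<delta>) = (1 / 2) ^ length \<delta> * conv a c \<delta>"
proof -
  let ?n = "Suc (length \<delta>)"
  have car: "A \<in> carrier_mat ?n ?n" "C \<in> carrier_mat ?n ?n"
    using A C by (simp_all add: coeffs_on_path_def)
  have "(A * C) $$ (0, length \<delta>) = (\<Sum>l\<in>{0..<?n}. A $$ (0, l) * C $$ (l, length \<delta>))"
    using car by (simp add: scalar_prod_def del: sum.op_ivl_Suc)
  also have "\<dots> = (\<Sum>l\<le>length \<delta>. (1 / 2) ^ length \<delta> * (a (take l \<delta>) * c (drop l \<delta>)))"
  proof (rule sum.cong)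
    fix l assume l: "l \<in> {..length \<delta>}"
    then have "(1 / 2 :: complex) ^ length \<delta> = (1 / 2) ^ l * (1 / 2) ^ (length \<delta> - l)"
      by (simp flip: power_add)
    then show "A $$ (0, l) * C $$ (l, length \<delta>) = (1 / 2) ^ length \<delta> * (a (take l \<delta>) * c (drop l \<delta>))"
      using A C l by (simp add: coeffs_on_path_def)
  qed auto
  finally show ?thesis by (simp add: conv_def sum_distrib_left)
qed

text \<open>The matrix identities \<open>(1 - B) H = 1 + B = H (1 - B)\<close> at the path tuple, read off in the upper
  right corner. The inverse exists there because \<open>1 - B\<close> is upper triangular with the nonzero constant
  \<open>1 - b []\<close> on the diagonal.\<close>

lemma nc_herglotz_conv:
  fixes B :: "('d::finite \<Rightarrow> complex mat) \<Rightarrow> complex mat"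
  assumes b: "nc_expansion B b" and h: "nc_expansion (nc_herglotz B) h" and b0: "b [] \<noteq> 1"
  shows "conv (\<lambda>\<gamma>. unit_series \<gamma> - b \<gamma>) h \<delta> = unit_series \<delta> + b \<delta>"
    and "conv h (\<lambda>\<gamma>. unit_series \<gamma> - b \<gamma>) \<delta> = unit_series \<delta> + b \<delta>"
proof -
  let ?n = "Suc (length \<delta>)"
  define A where "A = B (path_tuple \<delta>)"
  define H where "H = nc_herglotz B (path_tuple \<delta>)"
  let ?X = "1\<^sub>m ?n - A" and ?Y = "1\<^sub>m ?n + A"
  have tA: "coeffs_on_path \<delta> A b" and tH: "coeffs_on_path \<delta> H h"
    unfolding A_def H_def by (intro nc_expansion_coeffs_on_path b h)+
  note tX = coeffs_on_path_diff[OF coeffs_on_path_one tA] and tY = coeffs_on_path_add[OF coeffs_on_path_one tA]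
  have A: "A \<in> carrier_mat ?n ?n" using tA by (simp add: coeffs_on_path_def)
  then have X: "?X \<in> carrier_mat ?n ?n" and Y: "?Y \<in> carrier_mat ?n ?n" by auto
  have entry: "?X $$ (i, j) = (if i \<le> j then (1 / 2) ^ (j - i) *
      ((\<lambda>\<gamma>. unit_series \<gamma> - b \<gamma>) (take (j - i) (drop i \<delta>))) else 0)" if "i < ?n" "j < ?n" for i j
    using tX that unfolding coeffs_on_path_def less_Suc_eq_le by blast
  have "upper_triangular ?X"
    using entry X by (intro upper_triangularI) auto
  then have "det ?X = prod_list (diag_mat ?X)" using X by (rule det_upper_triangular)
  also have "diag_mat ?X = map (\<lambda>i. 1 - b []) [0..<?n]"
    unfolding diag_mat_def by (rule map_cong) (use X entry in \<open>auto simp del: upt_Suc\<close>)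
  finally have "det ?X \<noteq> 0" using b0 by (auto simp: prod_list_zero_iff)
  then have "?X \<in> Units (ring_mat TYPE(complex) ?n ())"
    by (rule det_non_zero_imp_unit[OF X])
  then obtain C where "mat_inverse ?X = Some C"
    using mat_inverse(1)[OF X, of "()"] by (cases "mat_inverse ?X") auto
  then have C: "?X * C = 1\<^sub>m ?n" "C * ?X = 1\<^sub>m ?n" "C \<in> carrier_mat ?n ?n" "H = C * ?Y"
    using mat_inverse(2)[OF X] A by (auto simp: H_def nc_herglotz_def A_def[symmetric] Let_def)
  have "?X * H = (?X * C) * ?Y" unfolding C(4) using assoc_mult_mat[OF X C(3) Y] by simp
  then have XH: "?X * H = ?Y" using left_mult_one_mat[OF Y] by (simp add: C(1))
  have "?Y * ?X = ?X * ?Y"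
  proof -
    have "?Y * ?X = 1\<^sub>m ?n * ?X + A * ?X"
      by (rule add_mult_distrib_mat[OF one_carrier_mat A X])
    also have "A * ?X = A * 1\<^sub>m ?n - A * A"
      by (rule mult_minus_distrib_mat[OF A one_carrier_mat A])
    finally have 1: "?Y * ?X = ?X + (A - A * A)" using X A by simp
    have "?X * ?Y = ?X * 1\<^sub>m ?n + ?X * A"
      by (rule mult_add_distrib_mat[OF X one_carrier_mat A])
    also have "?X * A = 1\<^sub>m ?n * A - A * A"
      by (rule minus_mult_distrib_mat[OF one_carrier_mat A A])
    finally show ?thesis using 1 X A by simp
  qed
  then have "H * ?X = C * (?X * ?Y)"
    unfolding C(4) using assoc_mult_mat[OF C(3) Y X] by simp
  also have "\<dots> = (C * ?X) * ?Y" using assoc_mult_mat[OF C(3) X Y] by simp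
  finally have HX: "H * ?X = ?Y" using left_mult_one_mat[OF Y] by (simp add: C(2))
  show "conv (\<lambda>\<gamma>. unit_series \<gamma> - b \<gamma>) h \<delta> = unit_series \<delta> + b \<delta>"
    using coeffs_on_path_mult_corner[OF tX tH] coeffs_on_path_corner[OF tY] unfolding XH by simp
  show "conv h (\<lambda>\<gamma>. unit_series \<gamma> - b \<gamma>) \<delta> = unit_series \<delta> + b \<delta>"
    using coeffs_on_path_mult_corner[OF tH tX] coeffs_on_path_corner[OF tY] unfolding HX by simp
qed

section \<open>Inner symbols and their Clark measures\<close>

text \<open>The coefficients of an inner symbol have norm one in the Fock space. If the constant coefficient were \<open>1\<close>, all others
  would vanish and \<open>B\<close> would be identically \<open>I\<close>.\<close>

lemma inner_expansion_constant_ne_1: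
  fixes B :: "('d::finite \<Rightarrow> complex mat) \<Rightarrow> complex mat"
  assumes b: "nc_expansion B b" and nontriv: "n \<ge> 1" "Z \<in> row_ball n" "B Z \<noteq> 1\<^sub>m n"
    and f: "\<And>\<gamma>. ell2_fun f \<gamma> = b (rev \<gamma>)" "norm f = 1"
  shows "b [] \<noteq> 1"
proof
  assume b1: "b [] = 1"
  have b0: "b \<gamma> = 0" if "\<gamma> \<noteq> []" for \<gamma>
  proof -
    have "(\<Sum>x\<in>{[], rev \<gamma>}. (cmod (ell2_fun f x))\<^sup>2) \<le> 1"
      using sum_coeff_le_norm[of "{[], rev \<gamma>}" f] f(2) by simp
    then show ?thesis using that f(1) b1 by simp
  qed
  have Zc: "Z k \<in> carrier_mat n n" for k using nontriv(2) by (simp add: row_ball_def)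
  have BZ: "B Z \<in> carrier_mat n n"
    and sum: "\<And>i j. i < n \<Longrightarrow> j < n \<Longrightarrow> ((\<lambda>\<alpha>. b \<alpha> * mat_word n Z \<alpha> $$ (i, j)) has_sum B Z $$ (i, j)) UNIV"
    using b nontriv(1,2) by (auto simp: nc_expansion_def)
  have "B Z $$ (i, j) = 1\<^sub>m n $$ (i, j)" if "i < n" "j < n" for i j
  proof -
    have "((\<lambda>\<alpha>. b \<alpha> * mat_word n Z \<alpha> $$ (i, j)) has_sum 1\<^sub>m n $$ (i, j)) {[]}"
      by (rule has_sum_finiteI) (auto simp: mat_word_def b1)
    then have "((\<lambda>\<alpha>. b \<alpha> * mat_word n Z \<alpha> $$ (i, j)) has_sum 1\<^sub>m n $$ (i, j)) UNIV"
      by (rule has_sum_cong_neutral[THEN iffD1, rotated -1]) (auto simp: b0)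
    with sum[OF that] show ?thesis by (rule has_sum_unique)
  qed
  then have "B Z = 1\<^sub>m n" using BZ by (intro eq_matI) auto
  with nontriv(3) show False by simp
qed

theorem corollary6p29:
  fixes B :: "('d::finite \<Rightarrow> complex mat) \<Rightarrow> complex mat"
    and \<mu> :: "'d list operator \<Rightarrow> complex"
  assumes "B \<in> nc_Hinfty_unit_ball"
    and "\<exists>n\<ge>1. \<exists>Z\<in>row_ball n. B Z \<noteq> 1\<^sub>m n"
    and "is_nc_clark_measure B \<mu>"
    and "nc_inner B"
  shows "singular_nc_measure \<mu>"
proof -
  obtain b M where b: "nc_expansion B b" and M: "is_left_mult b M"
    and iso: "\<And>f. norm (flip_word (M (flip_word f))) = norm f"
    using assms(4) unfolding nc_inner_def by blast
  obtain h where h: "nc_expansion (nc_herglotz B) h" and \<mu>: "positive_nc_measure \<mu>"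
    and \<mu>_id: "\<mu> id_blinfun = of_real (Re (h []))"
    and \<mu>_word: "\<And>\<alpha>. \<alpha> \<noteq> [] \<Longrightarrow> \<mu> (lshift_word \<alpha>) = cnj (h (rev \<alpha>)) / 2"
    using assms(3) unfolding is_nc_clark_measure_def by blast
  define N where "N f = flip_word (M (flip_word f))" for f
  define \<beta> where "\<beta> \<gamma> = b (rev \<gamma>)" for \<gamma>
  define c where "c \<alpha> = cnj (\<mu> (lshift_word \<alpha>))" for \<alpha>
  define h' where "h' \<gamma> = h (rev \<gamma>)" for \<gamma>
  have N: "ell2_fun (N f) \<gamma> = conv (ell2_fun f) \<beta> \<gamma>" for f \<gamma>
  proof -
    have "ell2_fun (N f) \<gamma> = conv b (ell2_fun (flip_word f)) (rev \<gamma>)"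
      using M by (simp add: N_def flip_word.rep_eq is_left_mult_def conv_def)
    then show ?thesis by (simp add: conv_rev flip_word.rep_eq \<beta>_def[abs_def])
  qed
  have "ell2_fun (N (ket [])) \<gamma> = b (rev \<gamma>)" for \<gamma>
    unfolding N ket.rep_eq conv_unit_left \<beta>_def ..
  then have b0: "b [] \<noteq> 1"
    using inner_expansion_constant_ne_1[OF b, of _ _ "N (ket [])"] assms(2) iso[of "ket []"]
    by (auto simp: N_def)
  have c: "c \<gamma> = (h' \<gamma> + cnj (h []) * unit_series \<gamma>) / 2" for \<gamma>
    using \<mu>_id \<mu>_word[of \<gamma>] by (auto simp: c_def h'_def complex_eq_iff)
  have unit_rev: "unit_series (rev \<gamma>) = unit_series \<gamma>" for \<gamma> :: "'d list" by simp
  \<comment> \<open>Reversing words turns the two identities for \<open>b\<close> and \<open>h\<close> into identities for \<open>\<beta>\<close> and \<open>h'\<close> in the opposite order.\<close>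
  have right: "h' \<gamma> - conv h' \<beta> \<gamma> = unit_series \<gamma> + \<beta> \<gamma>" for \<gamma>
    using nc_herglotz_conv(1)[OF b h b0, of "rev \<gamma>"]
    unfolding conv_rev unit_rev conv_diff_right conv_unit_right h'_def \<beta>_def .
  have left: "h' \<gamma> - conv \<beta> h' \<gamma> = unit_series \<gamma> + \<beta> \<gamma>" for \<gamma>
    using nc_herglotz_conv(2)[OF b h b0, of "rev \<gamma>"]
    unfolding conv_rev unit_rev conv_diff_left conv_unit_left h'_def \<beta>_def .
  let ?rhs = "\<lambda>\<gamma>. (unit_series \<gamma> - cnj (\<beta> []) * \<beta> \<gamma>) / (1 - cnj (\<beta> []))"
  have \<beta>0: "1 - cnj (\<beta> []) \<noteq> 0" using b0 by (simp add: \<beta>_def complex_eq_iff)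
  have "h [] - h [] * b [] = 1 + b []" using nc_herglotz_conv(2)[OF b h b0, of "[]"] by (simp add: right_diff_distrib)
  then have "cnj (h [] - h [] * b []) = cnj (1 + b [])" by simp
  then have h0: "cnj (h []) * (1 - cnj (\<beta> [])) = 1 + cnj (\<beta> [])"
    by (simp add: \<beta>_def right_diff_distrib)
  \<comment> \<open>Adding \<open>cnj (h [])\<close> times \<open>1 - B\<close> to \<open>1 + B\<close> gives a multiple of the kernel at the origin, since \<open>h [] = (1 + b []) / (1 - b [])\<close>.\<close>
  have combine: "(x + cnj (h []) * y) / 2 = (e - cnj (\<beta> []) * t) / (1 - cnj (\<beta> []))"
    if "x = e + t" "y = e - t" for x y e t
  proof -
    have "(x + cnj (h []) * y) * (1 - cnj (\<beta> []))
        = (e + t) * (1 - cnj (\<beta> [])) + (cnj (h []) * (1 - cnj (\<beta> []))) * (e - t)"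
      by (simp add: that algebra_simps)
    also have "\<dots> = 2 * (e - cnj (\<beta> []) * t)" unfolding h0 by (simp add: algebra_simps)
    finally show ?thesis using \<beta>0 by (simp add: field_simps)
  qed
  have c_fun: "c = (\<lambda>\<gamma>. (1 / 2) * (h' \<gamma> + cnj (h []) * unit_series \<gamma>))" by (simp add: c fun_eq_iff)
  have "c \<gamma> - conv c \<beta> \<gamma> = ?rhs \<gamma>" for \<gamma>
  proof -
    have "c \<gamma> - conv c \<beta> \<gamma> = ((h' \<gamma> - conv h' \<beta> \<gamma>) + cnj (h []) * (unit_series \<gamma> - \<beta> \<gamma>)) / 2"
      unfolding c_fun conv_scale_left conv_add_left conv_unit_left by (simp add: algebra_simps)
    also have "\<dots> = ?rhs \<gamma>" by (rule combine[OF right refl])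
    finally show ?thesis .
  qed
  moreover have "c \<gamma> - conv \<beta> c \<gamma> = ?rhs \<gamma>" for \<gamma>
  proof -
    have "c \<gamma> - conv \<beta> c \<gamma> = ((h' \<gamma> - conv \<beta> h' \<gamma>) + cnj (h []) * (unit_series \<gamma> - \<beta> \<gamma>)) / 2"
      unfolding c_fun conv_scale_right conv_add_right conv_unit_right by (simp add: algebra_simps)
    also have "\<dots> = ?rhs \<gamma>" by (rule combine[OF left refl])
    finally show ?thesis .
  qed
  ultimately interpret clark_vectors N \<beta> c \<mu>
    by unfold_locales (use N iso b0 \<mu> in \<open>simp_all add: N_def \<beta>_def c_def\<close>)
  show ?thesis by (rule singular)
qed

end
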